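(* Let $X$ be a minimal finite-velocity random motion in $\mathbb{R}^D$ with affinely independent velocities $v_0,\dots,v_D$, satisfying the two assumptions: changes of velocity depend only on the previously selected velocities; displacement durations relative to different velocities are independent (both made precise in the context). Let $H\in\{0,\dots,D-1\}$, let $I_H=\{i_0,\dots,i_H\}\subset\{0,\dots,D\}$ be a set of $H+1$ distinct indices and $I_{H^-}=\{0,\dots,D\}\setminus I_H$. Then the orthogonal projection $p_H:\mathbb{R}^D\to\mathbb{R}^H$ associated with $v_{i_0},\dots,v_{i_H}$ (defined in the context) exists, and $v_{i_0}^H=p_H(v_{i_0}),\dots,v_{i_H}^H=p_H(v_{i_H})$ are affinely independent. Furthermore, for $t\ge 0$, $x$ in the relative interior of $\mathrm{Conv}(v_{i_0}t,\dots,v_{i_H}t)$, integers $n_{i_0},\dots,n_{i_H}\ge 1$ with $n=n_{i_0}+\dots+n_{i_H}$, and $k\in\{0,\dots,H\}$, $$P\Big\{X(t)\in dx,\ \bigcap_{h=0}^H\{N_{i_h}(t)=n_{i_h}\},\ \bigcap_{i\in I_{H^-}}\{N_i(t)=0\},\ V(t)=v_{i_k}\Big\}\Big/dx$$ $$=\prod_{\substack{h=0\\ h\ne k}}^H f_{\sum_{j=1}^{n_{i_h}}W_j^{(i_h)}}\Big(\big(g_k^H\big)_h^{-1}(x^H)\Big)\ \Big|\det\big[v_i^H-v_{i_k}^H\big]_{i\in I_H,\,i\ne i_k}\Big|^{-1}\ P\Big\{N_{(i_k)}\Big(t-\sum_{\substack{h=0\\ h\ne k}}^H\big(g_k^H\big)_h^{-1}(x^H)\Big)=n_{i_k}-1\Big\}$$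 $$\times\ P\big\{C_n=(n_0,\dots,n_D),\ V(T_{n-1})=v_{i_k}\big\},$$ where $x^H=p_H(x)$, $\big(g_k^H\big)^{-1}(x^H)=\Big(\big(g_k^H\big)_h^{-1}(x^H)\Big)_{h\in\{0,\dots,H\},h\neq k}=\big[v_i^H-v_{i_k}^H\big]^{-1}_{i\in I_H,\,i\neq i_k}\,(x^H-v_{i_k}^Ht)$, and $n_i=0$ for $i\in I_{H^-}$.
   Context: Random motion. Let $(W_n)_{n\ge 0}$ be random variables with $W_n\ge 0$ a.s. and $W_0=0$ a.s., let $T_n=\sum_{i=0}^n W_i$ and $N(t)=\max\{n\ge 0:\ T_n\le t\}$, with $N(t)<\infty$ a.s. for all $t\ge 0$. Let $V=\{V(t)\}_{t\ge 0}$ take values in a finite set of velocities in $\mathbb{R}^D$ and change value only when $N$ records an event, so $V(t)=V(T_{N(t)})$. The random motion with velocity $V$ governed by $N$ is $X(t)=\int_0^tV(s)\,ds=\sum_{i=0}^{N(t)-1}(T_{i+1}-T_i)V(T_i)+(t-T_{N(t)})V(T_{N(t)})$. It is called minimal in $\mathbb{R}^D$ if it moves with $D+1$ affinely independent velocities $v_0,\dots,v_D\in\mathbb{R}^D$. Notation. $[v_i^H-v_{i_k}^H]_{i\in I_H,i\neq i_k}$ is the $H\times H$ matrix with these columns. $N_h(t)=|\{0\le j\le N(t):V(T_j)=v_h\}|$ counts the displacements with velocity $v_h$ in $[0,t]$ (including the current, incomplete one). For $n\ge 1$, $C_n=(C_{n,0},\dots,C_{n,D})$ with $C_{n,h}=|\{0\le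 j\le n-1: V(T_j)=v_h\}|$. $W^{(h)}_m$ is the duration of the $m$-th displacement with velocity $v_h$ (if $V(T_n)=v_h$ and this is the $m$-th selection of $v_h$ then $W_{n+1}=W^{(h)}_m$), and $N_{(h)}(s)=\max\{n\ge 0:\sum_{i=1}^nW_i^{(h)}\le s\}$, $s\ge 0$. $f_{\sum_{j=1}^{n}W^{(h)}_j}$ is the probability density of $\sum_{j=1}^nW^{(h)}_j$; these sums ($n\ge1$) are assumed absolutely continuous. Assumptions. (1) The changes of velocity, which can only occur when $N$ records an event, depend only on the previously selected velocities, not on the switching instants nor on the times spent with each velocity: with $\mathcal{F}_t$ the filtration to which all processes are adapted, $P\{V(t+dt)=v_h\mid N(t,t+dt]=1,\mathcal{F}_t\}=P\{V(t+dt)=v_h\mid N(t,t+dt]=1,\ V(T_j),\ j=0,\dots,N(t)\}$. Consequently the displacement durations are independent of the allocation of the velocities among the steps, i.e. the family $(W^{(h)}_m)_{h,m}$ is independent of the sequence $(V(T_n))_{n\ge0}$. (2) The sequences $(W^{(0)}_m)_{m\ge1},\dots,(W^{(D)}_m)_{m\ge1}$ are independent of each other (durations with the same velocity may be dependent). Projection. For vectors $u_0,\dots,u_m\in\mathbb{R}^D$ with $\dim\mathrm{Conv}(u_0,\dots,u_m)=R$, let $I^R$ be the set of indices of the first $R$ linearly independent rows (selected greedily from the top) of the matrix with columns $u_h-u_l$, $h\neq l$ (this set does not depend on $l$); $p_R:\mathbb{R}^D\to\mathbb{R}^R$ is the coordinate projection keeping the coordinates with index in $I^R$. Here it is applied to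 $u_h=v_{i_h}$, $h=0,\dots,H$, for which $R=H$. Meaning of the density. On the event considered, $X(t)$ lies in $\mathrm{Conv}(v_{i_0}t,\dots,v_{i_H}t)$, an $H$-dimensional set on which $p_H$ is injective; the density "$/dx$" is with respect to $H$-dimensional Lebesgue measure in the coordinates $x^H=p_H(x)$, i.e. it is the density of $p_H(X(t))$ on the given event. For $H=0$ the set is the single point $v_{i_0}t$, empty products and the empty determinant equal $1$, and the left side is the probability of the event. *)

theory Defs
  imports "HOL-Probability.Probability" "Jordan_Normal_Form.Determinant"
    "Jordan_Normal_Form.Gauss_Jordan_Elimination"
begin

no_notation Matrix.vec_index (infixl "$" 100)

section \<open>Random motions with finitely many velocities\<close>

definition arrival_time :: "(nat \<Rightarrow> 'a \<Rightarrow> real) \<Rightarrow> nat \<Rightarrow> 'a \<Rightarrow> real" where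
  "arrival_time W n \<omega> = (\<Sum>i=0..n. W i \<omega>)"

text \<open>\<open>max {n. S n \<le> t}\<close>, with value \<open>\<infinity>\<close> if there is no maximum because the set is infinite.\<close>

definition count_until :: "(nat \<Rightarrow> real) \<Rightarrow> real \<Rightarrow> enat" where
  "count_until S t = Sup (enat ` {n. S n \<le> t})"

definition point_process :: "(nat \<Rightarrow> 'a \<Rightarrow> real) \<Rightarrow> real \<Rightarrow> 'a \<Rightarrow> enat" where
  "point_process W t \<omega> = count_until (\<lambda>n. arrival_time W n \<omega>) t"

definition step_velocity :: "(nat \<Rightarrow> 'a \<Rightarrow> real) \<Rightarrow> (real \<Rightarrow> 'a \<Rightarrow> 'v) \<Rightarrow> nat \<Rightarrow> 'a \<Rightarrow> 'v" where
  "step_velocity W V n \<omega> = V (arrival_time W n \<omega>) \<omega>"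

text \<open>\<open>N\<^sub>h(t)\<close>: the displacements with velocity \<open>w\<close> in \<open>[0,t]\<close>, including the current one.\<close>

definition displacements ::
  "(nat \<Rightarrow> 'a \<Rightarrow> real) \<Rightarrow> (real \<Rightarrow> 'a \<Rightarrow> 'v) \<Rightarrow> 'v \<Rightarrow> real \<Rightarrow> 'a \<Rightarrow> nat" where
  "displacements W V w t \<omega> =
     card {j. enat j \<le> point_process W t \<omega> \<and> step_velocity W V j \<omega> = w}"

text \<open>\<open>C\<^bsub>n,h\<^esub>\<close>: the selections of \<open>w\<close> among the first \<open>n\<close> steps.\<close>

definition selections ::
  "(nat \<Rightarrow> 'a \<Rightarrow> real) \<Rightarrow> (real \<Rightarrow> 'a \<Rightarrow> 'v) \<Rightarrow> 'v \<Rightarrow> nat \<Rightarrow> 'a \<Rightarrow> nat" where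
  "selections W V w n \<omega> = card {j. j < n \<and> step_velocity W V j \<omega> = w}"

text \<open>
  The dimension \<open>D\<close> is \<open>CARD('d)\<close>; the linear order on \<open>'d\<close> is the order of the coordinates.
  \<open>Wd h m\<close> (\<open>h \<le> D\<close>, \<open>m \<ge> 1\<close>) is the duration of the \<open>m\<close>-th displacement with velocity \<open>v h\<close>.
  Assumption \<open>dur_indep_alloc\<close> is the independence of the durations and the allocation of the
  velocities among the steps, as independence of the generated sigma-algebras (which includes the
  measurability of the step velocities); \<open>dur_indep\<close> is that of the durations of different
  velocities.
\<close>

locale minimal_random_motion = prob_space M
  for M :: "'a measure" +
  fixes W :: "nat \<Rightarrow> 'a \<Rightarrow> real"
    and V X :: "real \<Rightarrow> 'a \<Rightarrow> real ^ 'd::{finite,linorder}"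
    and v :: "nat \<Rightarrow> real ^ 'd::{finite,linorder}"
    and Wd :: "nat \<Rightarrow> nat \<Rightarrow> 'a \<Rightarrow> real"
  assumes W_measurable: "\<And>n. random_variable borel (W n)"
    and W_nonneg: "\<And>n. AE \<omega> in M. 0 \<le> W n \<omega>"
    and W_0: "AE \<omega> in M. W 0 \<omega> = 0"
    and N_finite: "\<And>t. 0 \<le> t \<Longrightarrow> AE \<omega> in M. point_process W t \<omega> < \<infinity>"
    and v_inj: "inj_on v {0..CARD('d)}"
    and v_affine_indep: "\<not> affine_dependent (v ` {0..CARD('d)})"
    and V_measurable: "\<And>t. 0 \<le> t \<Longrightarrow> random_variable borel (V t)"
    and V_range: "\<And>t \<omega>. 0 \<le> t \<Longrightarrow> \<omega> \<in> space M \<Longrightarrow> V t \<omega> \<in> v ` {0..CARD('d)}"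
    and V_steps: "AE \<omega> in M. \<forall>t\<ge>0. V t \<omega> = step_velocity W V (the_enat (point_process W t \<omega>)) \<omega>"
    and X_measurable: "\<And>t. 0 \<le> t \<Longrightarrow> random_variable borel (X t)"
    and X_integral: "AE \<omega> in M. \<forall>t\<ge>0. X t \<omega> = integral {0..t} (\<lambda>s. V s \<omega>)"
    and dur_nonneg: "\<And>h m. h \<le> CARD('d) \<Longrightarrow> 1 \<le> m \<Longrightarrow> AE \<omega> in M. 0 \<le> Wd h m \<omega>"
    and dur_steps: "AE \<omega> in M. \<forall>n. \<forall>h\<le>CARD('d). step_velocity W V n \<omega> = v h \<longrightarrow>
          W (Suc n) \<omega> = Wd h (selections W V (v h) (Suc n) \<omega>) \<omega>"
    and dur_indep_alloc: "indep_set
          (sets (vimage_algebra (space M)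
             (\<lambda>\<omega>. \<lambda>(h, m)\<in>{0..CARD('d)} \<times> {1..}. Wd h m \<omega>)
             (PiM ({0..CARD('d)} \<times> {1..}) (\<lambda>_. borel))))
          (sets (vimage_algebra (space M)
             (\<lambda>\<omega> n. step_velocity W V n \<omega>) (PiM UNIV (\<lambda>_. borel))))"
    and dur_indep: "indep_vars (\<lambda>_. PiM {1..} (\<lambda>_. borel)) (\<lambda>h \<omega>. \<lambda>m\<in>{1..}. Wd h m \<omega>) {0..CARD('d)}"

definition duration_sum :: "(nat \<Rightarrow> nat \<Rightarrow> 'a \<Rightarrow> real) \<Rightarrow> nat \<Rightarrow> nat \<Rightarrow> 'a \<Rightarrow> real" where
  "duration_sum Wd h n \<omega> = (\<Sum>j=1..n. Wd h j \<omega>)"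

section \<open>The projection associated with a family of points\<close>

text \<open>
  Linear independence of the rows with index in \<open>S\<close>, as a family, of the matrix with columns
  \<open>u h - u l\<close>, \<open>h \<in> {0..m} - {l}\<close>.
\<close>

definition rows_independent ::
  "(nat \<Rightarrow> real ^ 'd::finite) \<Rightarrow> nat \<Rightarrow> nat \<Rightarrow> 'd set \<Rightarrow> bool" where
  "rows_independent u m l S \<longleftrightarrow>
     (\<forall>c. (\<forall>h\<in>{0..m} - {l}. (\<Sum>r\<in>S. c r * (u h $ r - u l $ r)) = 0) \<longrightarrow> (\<forall>r\<in>S. c r = 0))"

text \<open>
  Greedy selection in increasing order of the rows. It selects as many rows as the rank of the
  matrix, which is the dimension of the convex hull of the points.
\<close>

definition first_independent_rows ::
  "(nat \<Rightarrow> real ^ 'd::{finite,linorder}) \<Rightarrow> nat \<Rightarrow> nat \<Rightarrow> 'd set" where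
  "first_independent_rows u m l =
     fold (\<lambda>r S. if rows_independent u m l (insert r S) then insert r S else S)
       (sorted_list_of_set UNIV) {}"

text \<open>
  Vectors of \<open>\<real>\<^sup>R\<close>, where \<open>R\<close> is not the cardinality of a fixed type, are elements of
  \<open>PiE {..<R} (\<lambda>_. UNIV)\<close>.
\<close>

definition coordinate_projection ::
  "'d::{finite,linorder} set \<Rightarrow> real ^ 'd::{finite,linorder} \<Rightarrow> nat \<Rightarrow> real" where
  "coordinate_projection I x = (\<lambda>a\<in>{..<card I}. x $ (sorted_list_of_set I ! a))"

text \<open>The base point \<open>u 0\<close> is an arbitrary choice.\<close>

definition hull_projection ::
  "(nat \<Rightarrow> real ^ 'd::{finite,linorder}) \<Rightarrow> nat \<Rightarrow> real ^ 'd::{finite,linorder} \<Rightarrow> nat \<Rightarrow> real" where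
  "hull_projection u m = coordinate_projection (first_independent_rows u m 0)"

definition affinely_independent_family :: "nat \<Rightarrow> nat set \<Rightarrow> (nat \<Rightarrow> nat \<Rightarrow> real) \<Rightarrow> bool" where
  "affinely_independent_family R A w \<longleftrightarrow>
     (\<forall>c. (\<Sum>h\<in>A. c h) = 0 \<and> (\<forall>a<R. (\<Sum>h\<in>A. c h * w h a) = 0) \<longrightarrow> (\<forall>h\<in>A. c h = 0))"

text \<open>
  For \<open>w 0, \<dots>, w H\<close> in \<open>\<real>\<^sup>H\<close>: the matrix with columns \<open>w h - w k\<close>, \<open>h \<noteq> k\<close>. The maps
  \<open>insert_index k\<close> and \<open>delete_index k\<close> translate between \<open>{0..<H}\<close> and \<open>{0..H} - {k}\<close>.
\<close>

definition difference_matrix :: "(nat \<Rightarrow> nat \<Rightarrow> real) \<Rightarrow> nat \<Rightarrow> nat \<Rightarrow> real mat" where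
  "difference_matrix w H k = Matrix.mat H H (\<lambda>(a, b). w (insert_index k b) a - w k a)"

text \<open>
  \<open>(g\<^sub>k)\<^sub>h\<^sup>-\<^sup>1(y)\<close>, for \<open>h \<in> {0..H} - {k}\<close>: the component \<open>h\<close> of the inverse of the difference
  matrix applied to \<open>y - t w\<^sub>k\<close>.
\<close>

definition g_inverse ::
  "(nat \<Rightarrow> nat \<Rightarrow> real) \<Rightarrow> nat \<Rightarrow> nat \<Rightarrow> real \<Rightarrow> (nat \<Rightarrow> real) \<Rightarrow> nat \<Rightarrow> real" where
  "g_inverse w H k t y h =
     Matrix.vec_index
       (the (mat_inverse (difference_matrix w H k)) *\<^sub>v Matrix.vec H (\<lambda>a. y a - t * w k a))
       (delete_index k h)"

section \<open>Densities on an event\<close>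

text \<open>
  \<open>P{Y \<in> dy, E}/dy = g y\<close> for \<open>y \<in> U\<close>, with \<open>dy\<close> the reference measure \<open>L\<close>.
\<close>

definition has_density_on ::
  "'a measure \<Rightarrow> 'b measure \<Rightarrow> ('a \<Rightarrow> 'b) \<Rightarrow> 'a set \<Rightarrow> 'b set \<Rightarrow> ('b \<Rightarrow> ennreal) \<Rightarrow> bool" where
  "has_density_on M L Y E U g \<longleftrightarrow>
     (\<forall>B\<in>sets L. B \<subseteq> U \<longrightarrow>
        {\<omega> \<in> space M. Y \<omega> \<in> B} \<inter> E \<in> sets M \<and>
        (\<lambda>y. g y * indicator B y) \<in> borel_measurable L \<and>
        emeasure M ({\<omega> \<in> space M. Y \<omega> \<in> B} \<inter> E) = (\<integral>\<^sup>+ y. g y * indicator B y \<partial>L))"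

end

theory Submission
  imports Defs
begin

text \<open>
  The idea is that the position and the event depend on the path only through a few random variables.
  Write \<open>n\<^sub>h\<close> for \<open>n (i h)\<close>, let \<open>n\<close> be the sum of these numbers, write \<open>u\<^sub>h\<close> for the velocity with index \<open>i h\<close>, and let
  \<open>S\<^sub>h\<close> be the total duration of its first \<open>n\<^sub>h\<close> displacements. The event says that exactly \<open>n\<close>
  displacements have begun by time \<open>t\<close>, that they are distributed among the velocities according to
  the \<open>n\<^sub>h\<close>, and that the current one has velocity \<open>u\<^sub>k\<close>. A duration is determined by the velocity and by
  the rank of the displacement among those with that velocity, so the order of the velocities does not
  matter: each \<open>u\<^sub>h\<close> with \<open>h \<noteq> k\<close> has been followed for the time \<open>S\<^sub>h\<close>, and \<open>u\<^sub>k\<close> for the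
  remaining time \<open>r = t - (\<Sum>h\<noteq>k. S\<^sub>h)\<close>. Hence \<open>X(t) = t u\<^sub>k + (\<Sum>h\<noteq>k. S\<^sub>h (u\<^sub>h - u\<^sub>k))\<close>, and
  the number of displacements is right iff \<open>r\<close> lies between the partial sums of order \<open>n\<^sub>k - 1\<close> and
  \<open>n\<^sub>k\<close> of the durations with velocity \<open>u\<^sub>k\<close> (\<open>allocation_path\<close>, \<open>event_iff\<close>).

  The four factors of the density can now be read off. The allocation is independent of all durations,
  which splits off its probability (\<open>emeasure_event\<close>). The \<open>S\<^sub>h\<close>, \<open>h \<noteq> k\<close>, are independent with
  densities \<open>f\<close> and jointly independent of the durations with velocity \<open>u\<^sub>k\<close>; integrating over their
  values leaves the probability that the count of displacements of \<open>u\<^sub>k\<close> at \<open>r\<close> is \<open>n\<^sub>k - 1\<close>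
  (\<open>emeasure_indep_var\<close>, \<open>distr_indep_density\<close>, \<open>count_last_velocity\<close>). Finally the projected
  position is an affine image of \<open>(S\<^sub>h)\<close> whose matrix is the difference matrix, so the change of variables
  produces the inverse of its determinant (\<open>nn_integral_PiM_affine\<close>).

  The projection is harmless because the greedily selected rows are a maximal independent set: every
  other row is a combination of them, so an affine relation between the projected points is one between
  the points themselves (\<open>affine_independent_selected_rows\<close>). Equality of row rank and column rank then
  shows that there are \<open>H\<close> selected rows (\<open>card_first_independent_rows\<close>).
\<close>

section \<open>The coordinates selected by the projection\<close>

text \<open>
  A combination of the rows kills all differences \<open>u h - u l\<close> iff it takes the same value at all
  points. In this form the base point \<open>l\<close> has disappeared.
\<close>

lemma rows_independent_constant_iff:
  assumes "l \<le> m"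
  shows "rows_independent u m l S \<longleftrightarrow>
    (\<forall>c. (\<forall>h\<le>m. \<forall>h'\<le>m. (\<Sum>r\<in>S. c r * u h $ r) = (\<Sum>r\<in>S. c r * u h' $ r)) \<longrightarrow>
       (\<forall>r\<in>S. c r = 0))"
proof -
  have "(\<forall>h\<in>{0..m} - {l}. (\<Sum>r\<in>S. c r * (u h $ r - u l $ r)) = 0) \<longleftrightarrow>
      (\<forall>h\<le>m. \<forall>h'\<le>m. (\<Sum>r\<in>S. c r * u h $ r) = (\<Sum>r\<in>S. c r * u h' $ r))" for c
  proof -
    have "(\<Sum>r\<in>S. c r * (u h $ r - u l $ r)) = (\<Sum>r\<in>S. c r * u h $ r) - (\<Sum>r\<in>S. c r * u l $ r)" for h
      by (simp add: right_diff_distrib sum_subtractf)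
    then have "(\<forall>h\<in>{0..m} - {l}. (\<Sum>r\<in>S. c r * (u h $ r - u l $ r)) = 0) \<longleftrightarrow>
        (\<forall>h\<le>m. (\<Sum>r\<in>S. c r * u h $ r) = (\<Sum>r\<in>S. c r * u l $ r))"
      by (auto simp: Ball_def)
    also have "\<dots> \<longleftrightarrow>
        (\<forall>h\<le>m. \<forall>h'\<le>m. (\<Sum>r\<in>S. c r * u h $ r) = (\<Sum>r\<in>S. c r * u h' $ r))"
      using assms by metis
    finally show ?thesis .
  qed
  then show ?thesis
    unfolding rows_independent_def by simp
qed

lemma first_independent_rows_base_point:
  assumes "l \<le> m"
  shows "first_independent_rows u m l = first_independent_rows u m 0"
proof -
  have "rows_independent u m l = rows_independent u m 0"
    by (rule ext) (simp only: rows_independent_constant_iff[OF assms]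
        rows_independent_constant_iff[of 0 m] le0)
  then show ?thesis
    unfolding first_independent_rows_def by simp
qed

lemma rows_independent_mono:
  assumes "rows_independent u m l T" "S \<subseteq> T"
  shows "rows_independent u m l S"
  unfolding rows_independent_def
proof (intro allI impI)
  fix c assume c: "\<forall>h\<in>{0..m} - {l}. (\<Sum>r\<in>S. c r * (u h $ r - u l $ r)) = 0"
  define c' where "c' r = (if r \<in> S then c r else 0)" for r
  have "(\<Sum>r\<in>T. c' r * x r) = (\<Sum>r\<in>S. c r * x r)" for x
    using assms(2) by (intro sum.mono_neutral_cong_right) (auto simp: c'_def)
  then have "\<forall>r\<in>T. c' r = 0"
    using c assms(1) unfolding rows_independent_def by simp
  then show "\<forall>r\<in>S. c r = 0"
    using assms(2) by (force simp: c'_def)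
qed

text \<open>
  An element that was rejected was dependent on what had been selected by then, hence, the property
  being inherited by subsets, it also is on the final selection.
\<close>

lemma greedy_selection_maximal:
  fixes P :: "'b set \<Rightarrow> bool"
  assumes mono: "\<And>S T. P T \<Longrightarrow> S \<subseteq> T \<Longrightarrow> P S" and "P Q"
  defines "G \<equiv> fold (\<lambda>r S. if P (insert r S) then insert r S else S)"
  shows "P (G xs Q) \<and> Q \<subseteq> G xs Q \<and> (\<forall>r\<in>set xs. P (insert r (G xs Q)) \<longrightarrow> r \<in> G xs Q)"
  using \<open>P Q\<close>
proof (induction xs arbitrary: Q)
  case (Cons x xs)
  define S1 where "S1 = (if P (insert x Q) then insert x Q else Q)"
  have "P S1" "Q \<subseteq> S1"
    using Cons.prems by (auto simp: S1_def)
  moreover have "G (x # xs) Q = G xs S1"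
    by (simp add: G_def S1_def)
  moreover have "x \<in> G xs S1" if "P (insert x (G xs S1))"
    using mono[OF that, of "insert x Q"] Cons.IH[OF \<open>P S1\<close>] \<open>Q \<subseteq> S1\<close>
    by (auto simp: S1_def)
  ultimately show ?case
    using Cons.IH[of S1] by auto
qed (simp add: G_def)

lemma first_independent_rows_maximal:
  fixes u :: "nat \<Rightarrow> real ^ 'd::{finite,linorder}"
  shows "rows_independent u m l (first_independent_rows u m l)"
    and "r \<notin> first_independent_rows u m l \<Longrightarrow>
      \<not> rows_independent u m l (insert r (first_independent_rows u m l))"
proof -
  have "rows_independent u m l {}"
    by (simp add: rows_independent_def)
  then have "rows_independent u m l (first_independent_rows u m l) \<and>
      {} \<subseteq> first_independent_rows u m l \<and>
      (\<forall>r\<in>set (sorted_list_of_set UNIV).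
        rows_independent u m l (insert r (first_independent_rows u m l)) \<longrightarrow>
        r \<in> first_independent_rows u m l)"
    unfolding first_independent_rows_def
    by (rule greedy_selection_maximal[where P="rows_independent u m l", rotated])
       (rule rows_independent_mono)
  then show "rows_independent u m l (first_independent_rows u m l)"
    and "r \<notin> first_independent_rows u m l \<Longrightarrow>
      \<not> rows_independent u m l (insert r (first_independent_rows u m l))"
    by auto
qed

text \<open>
  The predicate \<open>affine_dependent\<close> is about sets of points; injectivity transfers it to the indexed family.
\<close>

lemma affine_independent_coefficients_zero:
  fixes u :: "nat \<Rightarrow> real ^ 'd"
  assumes "inj_on u {0..m}" "\<not> affine_dependent (u ` {0..m})"
    and "(\<Sum>h=0..m. c h) = 0" "(\<Sum>h=0..m. c h *\<^sub>R u h) = 0" "h \<le> m"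
  shows "c h = 0"
proof -
  define U where "U = (\<lambda>x. c (the_inv_into {0..m} u x))"
  have U: "U (u h) = c h" if "h \<le> m" for h
    using that assms(1) by (simp add: U_def the_inv_into_f_f)
  have "sum U (u ` {0..m}) = 0" "(\<Sum>x\<in>u ` {0..m}. U x *\<^sub>R x) = 0"
    using assms(1,3,4) by (simp_all add: sum.reindex U)
  then have "U (u h) = 0"
    using assms(2,5) by (auto simp: affine_dependent_explicit_finite)
  then show ?thesis
    using U assms(5) by simp
qed

text \<open>
  A row that is not selected is a combination of selected ones, by maximality. So an affine relation
  which holds in the selected coordinates holds in all of them.
\<close>

lemma affine_independent_selected_rows:
  fixes u :: "nat \<Rightarrow> real ^ 'd::{finite,linorder}"
  assumes u: "inj_on u {0..m}" "\<not> affine_dependent (u ` {0..m})"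
    and c: "(\<Sum>h=0..m. c h) = 0" "\<And>r. r \<in> first_independent_rows u m 0 \<Longrightarrow> (\<Sum>h=0..m. c h * u h $ r) = 0"
    and h: "h \<le> m"
  shows "c h = 0"
proof -
  let ?I = "first_independent_rows u m 0"
  have "(\<Sum>h=0..m. c h * u h $ r) = 0" for r
  proof (cases "r \<in> ?I")
    case False
    from first_independent_rows_maximal(2)[OF False] obtain d where
      d: "\<And>h. h \<in> {0..m} - {0} \<Longrightarrow> (\<Sum>s\<in>insert r ?I. d s * (u h $ s - u 0 $ s)) = 0"
      and nz: "\<exists>s\<in>insert r ?I. d s \<noteq> 0"
      unfolding rows_independent_def by blast
    have d': "d r * (u h $ r - u 0 $ r) + (\<Sum>s\<in>?I. d s * (u h $ s - u 0 $ s)) = 0"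
      if "h \<in> {0..m}" for h
      using d[of h] that False by (cases "h = 0") auto
    have "d r \<noteq> 0"
    proof
      assume "d r = 0"
      then have "\<forall>s\<in>?I. d s = 0"
        using d' first_independent_rows_maximal(1)[of u m 0] unfolding rows_independent_def by simp
      then show False
        using nz \<open>d r = 0\<close> by auto
    qed
    have diff: "(\<Sum>h=0..m. c h * (u h $ s - u 0 $ s)) = (\<Sum>h=0..m. c h * u h $ s)" for s
      using c(1) by (simp add: right_diff_distrib sum_subtractf sum_distrib_right[symmetric])
    have "0 = (\<Sum>h=0..m. c h * (d r * (u h $ r - u 0 $ r) + (\<Sum>s\<in>?I. d s * (u h $ s - u 0 $ s))))"
      using d' by simp
    also have "\<dots> = (\<Sum>h=0..m. d r * (c h * (u h $ r - u 0 $ r))) +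
        (\<Sum>h=0..m. \<Sum>s\<in>?I. d s * (c h * (u h $ s - u 0 $ s)))"
      by (simp add: distrib_left sum.distrib sum_distrib_left mult_ac)
    also have "\<dots> = d r * (\<Sum>h=0..m. c h * (u h $ r - u 0 $ r)) +
        (\<Sum>s\<in>?I. d s * (\<Sum>h=0..m. c h * (u h $ s - u 0 $ s)))"
      by (subst sum.swap) (simp only: sum_distrib_left)
    also have "\<dots> = d r * (\<Sum>h=0..m. c h * u h $ r)"
      unfolding diff using c(2) by simp
    finally show ?thesis
      using \<open>d r \<noteq> 0\<close> by simp
  qed (rule c(2))
  then have "(\<Sum>h=0..m. c h *\<^sub>R u h) = 0"
    by (simp add: Finite_Cartesian_Product.vec_eq_iff)
  from affine_independent_coefficients_zero[OF u c(1) this h] show ?thesis .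
qed

text \<open>
  Row rank equals column rank. The columns restricted to the selected rows stay independent and hence
  span a space of dimension \<open>m\<close>. This space is all of the coordinate subspace of the selected rows, as a
  vector orthogonal to it would be a relation between the rows.
\<close>

lemma card_first_independent_rows:
  fixes u :: "nat \<Rightarrow> real ^ 'd::{finite,linorder}"
  assumes u: "inj_on u {0..m}" "\<not> affine_dependent (u ` {0..m})"
  shows "card (first_independent_rows u m 0) = m"
proof -
  define I where "I = first_independent_rows u m 0"
  define q :: "nat \<Rightarrow> real ^ 'd::{finite,linorder}" where "q h = (\<chi> r. if r \<in> I then u h $ r - u 0 $ r else 0)" for h
  define T where "T = {x :: real ^ 'd::{finite,linorder}. \<forall>r. r \<notin> I \<longrightarrow> x $ r = 0}"
  have q0: "c h = 0" if c: "(\<Sum>h=1..m. c h *\<^sub>R q h) = 0" and h: "h \<in> {1..m}" for c h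
  proof -
    \<comment> \<open>The coefficient of the base point that turns a linear relation between differences into an affine one.\<close>
    define c' where "c' h = (if h = 0 then - (\<Sum>h=1..m. c h) else c h)" for h
    have split: "(\<Sum>h=0..m. c' h * x h) = (\<Sum>h=1..m. c h * (x h - x 0))" for x
    proof -
      have "(\<Sum>h=0..m. c' h * x h) = c' 0 * x 0 + (\<Sum>h=1..m. c' h * x h)"
        by (subst sum.atLeast_Suc_atMost[of 0 m]) simp_all
      also have "(\<Sum>h=1..m. c' h * x h) = (\<Sum>h=1..m. c h * x h)"
        by (intro sum.cong) (auto simp: c'_def)
      finally show ?thesis
        by (simp add: c'_def right_diff_distrib sum_subtractf sum_distrib_right[symmetric])
    qed
    have "(\<Sum>h=0..m. c' h) = 0"
      using split[of "\<lambda>_. 1"] by simp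
    moreover have "(\<Sum>h=0..m. c' h * u h $ r) = 0" if "r \<in> first_independent_rows u m 0" for r
      using arg_cong[OF c, of "\<lambda>x. x $ r"] that unfolding split[of "\<lambda>h. u h $ r"]
      by (simp add: q_def I_def)
    moreover have "h \<le> m"
      using h by simp
    ultimately have "c' h = 0"
      by (rule affine_independent_selected_rows[OF u, where c=c' and h=h])
    then show ?thesis
      using h by (simp add: c'_def)
  qed
  have inj: "inj_on q {1..m}"
  proof (rule inj_onI, rule ccontr)
    fix h h' assume h: "h \<in> {1..m}" "h' \<in> {1..m}" "q h = q h'" "h \<noteq> h'"
    define c where "c = (\<lambda>j. of_bool (j = h) - of_bool (j = h') :: real)"
    have "(\<Sum>j=1..m. c j *\<^sub>R q j) = (\<Sum>j=1..m. of_bool (j = h) *\<^sub>R q j) - (\<Sum>j=1..m. of_bool (j = h') *\<^sub>R q j)"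
      by (simp add: c_def scaleR_diff_left sum_subtractf)
    also have "\<dots> = 0"
      using h by (simp add: of_bool_def if_distrib[of "\<lambda>x. x *\<^sub>R _"] cong: if_cong)
    finally have "c h = 0"
      using h(1) by (rule q0)
    then show False
      using h(4) by (simp add: c_def)
  qed
  have "independent (q ` {1..m})"
  proof (rule independent_if_scalars_zero)
    fix f x assume f: "(\<Sum>x\<in>q ` {1..m}. f x *\<^sub>R x) = 0" and x: "x \<in> q ` {1..m}"
    then show "f x = 0"
      using q0[of "\<lambda>h. f (q h)"] inj by (auto simp: sum.reindex)
  qed simp
  then have dimQ: "dim (q ` {1..m}) = m"
    using card_image[OF inj] by (simp add: dim_eq_card_independent)
  have "subspace T"
    by (auto simp: T_def subspace_def)
  moreover have "dim T = card I"
    using dim_substandard_cart[of I, where 'a=real] unfolding T_def dim_vec_eq .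
  ultimately have T: "subspace T" "dim T = card I"
    by auto
  have QT: "span (q ` {1..m}) \<subseteq> span T"
    by (rule span_mono) (auto simp: q_def T_def)
  have "span (q ` {1..m}) = span T"
  proof (rule ccontr)
    assume "span (q ` {1..m}) \<noteq> span T"
    with QT have "span (q ` {1..m}) \<subset> span T" by blast
    then have "\<exists>x. x \<noteq> 0 \<and> x \<in> span T \<and>
        (\<forall>y\<in>span (q ` {1..m}). real_inner_class.orthogonal x y)"
      by (rule orthogonal_to_subspace_exists_gen) blast
    then obtain x where x: "x \<noteq> 0" "x \<in> span T"
      "\<And>y. y \<in> span (q ` {1..m}) \<Longrightarrow> real_inner_class.orthogonal x y"
      by blast
    have "span T = T"
      using T(1) by (simp only: span_eq_iff)
    with x(2) have "x \<in> T"
      by (simp only:)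
    then have xT: "x $ r = 0" if "r \<notin> I" for r
      using that unfolding T_def by blast
    have "\<forall>h\<in>{0..m} - {0}. (\<Sum>r\<in>I. x $ r * (u h $ r - u 0 $ r)) = 0"
    proof
      fix h assume "h \<in> {0..m} - {0}"
      then have "q h \<in> span (q ` {1..m})"
        by (intro span_base imageI) simp
      then have "real_inner_class.orthogonal x (q h)"
        by (rule x(3))
      then have "(\<Sum>r\<in>UNIV. x $ r * q h $ r) = 0"
        by (simp only: real_inner_class.orthogonal_def inner_vec_def inner_real_def)
      moreover have "(\<Sum>r\<in>UNIV. x $ r * q h $ r) = (\<Sum>r\<in>I. x $ r * (u h $ r - u 0 $ r))"
        by (rule sum.mono_neutral_cong_right) (simp_all add: q_def)
      ultimately show "(\<Sum>r\<in>I. x $ r * (u h $ r - u 0 $ r)) = 0"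
        by (simp only:)
    qed
    then have "\<forall>r\<in>I. x $ r = 0"
      by (rule first_independent_rows_maximal(1)[of u m 0, folded I_def, unfolded rows_independent_def,
            THEN spec[of _ "\<lambda>r. x $ r"], THEN mp])
    then have "x = 0"
      using xT by (auto simp: Finite_Cartesian_Product.vec_eq_iff)
    with x(1) show False by simp
  qed
  then have "dim (span (q ` {1..m})) = dim (span T)"
    by (rule arg_cong)
  then have "dim (q ` {1..m}) = dim T"
    by (simp only: dim_span)
  then show ?thesis
    using dimQ T(2) by (simp add: I_def)
qed

lemma coordinate_projection_nth:
  assumes "r \<in> I"
  shows "\<exists>a<card I. \<forall>x. coordinate_projection I x a = x $ r"
proof -
  have "r \<in> set (sorted_list_of_set I)"
    using assms by simp
  then obtain a where a: "a < length (sorted_list_of_set I)" "sorted_list_of_set I ! a = r"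
    by (auto simp only: in_set_conv_nth)
  then have "a < card I" "\<forall>x. coordinate_projection I x a = x $ r"
    by (simp_all add: coordinate_projection_def)
  then show ?thesis by blast
qed

lemma affinely_independent_hull_projection:
  fixes u :: "nat \<Rightarrow> real ^ 'd::{finite,linorder}"
  assumes u: "inj_on u {0..m}" "\<not> affine_dependent (u ` {0..m})"
  shows "affinely_independent_family m {0..m} (\<lambda>h. hull_projection u m (u h))"
  unfolding affinely_independent_family_def
proof (intro allI impI ballI)
  fix c h
  assume c: "(\<Sum>h=0..m. c h) = 0 \<and> (\<forall>a<m. (\<Sum>h=0..m. c h * hull_projection u m (u h) a) = 0)"
    and h: "h \<in> {0..m}"
  show "c h = 0"
  proof (rule affine_independent_selected_rows[OF u, where c=c and h=h])
    fix r assume "r \<in> first_independent_rows u m 0"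
    then obtain a where a: "a < card (first_independent_rows u m 0)"
      "\<And>x. hull_projection u m x a = x $ r"
      using coordinate_projection_nth[of r "first_independent_rows u m 0"]
      by (auto simp only: hull_projection_def)
    have "a < m"
      using a(1) by (simp add: card_first_independent_rows[OF u])
    with c have "(\<Sum>h=0..m. c h * hull_projection u m (u h) a) = 0"
      by simp
    then show "(\<Sum>h=0..m. c h * u h $ r) = 0"
      by (simp add: a(2))
  qed (use c h in auto)
qed

section \<open>Barycentric coordinates of the projected simplex\<close>

lemma bij_betw_insert_index:
  assumes "k \<le> H"
  shows "bij_betw (insert_index k) {..<H} ({0..H} - {k})"
proof (rule bij_betw_imageI)
  show "inj_on (insert_index k) {..<H}"
    by (rule insert_index_inj_on)
  show "insert_index k ` {..<H} = {0..H} - {k}"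
    using insert_index_image[of k H] assms
    by (simp add: atLeast0LessThan atLeastLessThanSuc_atLeastAtMost)
qed

lemma det_difference_matrix_nonzero:
  assumes w: "affinely_independent_family H {0..H} w" and k: "k \<le> H"
  shows "Determinant.det (difference_matrix w H k) \<noteq> 0"
proof
  let ?A = "difference_matrix w H k"
  have A: "?A \<in> carrier_mat H H"
    by (simp add: difference_matrix_def)
  assume "Determinant.det ?A = 0"
  then obtain x where x: "x \<in> carrier_vec H" "x \<noteq> 0\<^sub>v H" "?A *\<^sub>v x = 0\<^sub>v H"
    using det_0_iff_vec_prod_zero_field[OF A] by auto
  define c where "c h = (if h = k then - (\<Sum>b<H. vec_index x b) else vec_index x (delete_index k h))" for h
  have split: "(\<Sum>h=0..H. c h * y h) = (\<Sum>b<H. vec_index x b * (y (insert_index k b) - y k))" for y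
  proof -
    have "(\<Sum>h=0..H. c h * y h) = c k * y k + (\<Sum>h\<in>{0..H}-{k}. c h * y h)"
      using k by (intro sum.remove) auto
    also have "(\<Sum>h\<in>{0..H}-{k}. c h * y h) = (\<Sum>b<H. c (insert_index k b) * y (insert_index k b))"
      by (rule sum.reindex_bij_betw[symmetric, OF bij_betw_insert_index[OF k]])
    also have "\<dots> = (\<Sum>b<H. vec_index x b * y (insert_index k b))"
      by (simp add: c_def insert_index_exclude)
    finally show ?thesis
      by (simp add: c_def right_diff_distrib sum_subtractf sum_distrib_right)
  qed
  have "(\<Sum>h=0..H. c h) = 0"
    using split[of "\<lambda>_. 1"] by simp
  moreover have "(\<Sum>h=0..H. c h * w h a) = 0" if "a < H" for a
  proof -
    have "(\<Sum>h=0..H. c h * w h a) = vec_index (?A *\<^sub>v x) a"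
      using that x(1) unfolding split[of "\<lambda>h. w h a"]
      by (simp add: difference_matrix_def scalar_prod_def atLeast0LessThan mult.commute)
    then show ?thesis
      using that x(3) by simp
  qed
  ultimately have c: "c h = 0" if "h \<le> H" for h
    using w that unfolding affinely_independent_family_def by simp
  have "vec_index x b = 0" if "b < H" for b
  proof -
    have "insert_index k b \<le> H"
      using that by (simp add: insert_index_def)
    from c[OF this] show ?thesis
      by (simp add: c_def insert_index_exclude)
  qed
  then have "x = 0\<^sub>v H"
    using x(1) by (intro eq_vecI) auto
  with x(2) show False by simp
qed

lemma mat_inverse_difference_matrix:
  assumes w: "affinely_independent_family H {0..H} w" and k: "k \<le> H"
  obtains B where "mat_inverse (difference_matrix w H k) = Some B" "B \<in> carrier_mat H H"
    "B * difference_matrix w H k = 1\<^sub>m H"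
proof -
  let ?A = "difference_matrix w H k"
  have A: "?A \<in> carrier_mat H H"
    by (simp add: difference_matrix_def)
  have "?A \<in> Units (ring_mat TYPE(real) H ())"
    by (rule det_non_zero_imp_unit[OF A det_difference_matrix_nonzero[OF w k]])
  then have "mat_inverse ?A \<noteq> None"
    using mat_inverse(1)[OF A] by metis
  then obtain B where B: "mat_inverse ?A = Some B"
    by blast
  show ?thesis
    by (rule that[OF B]) (use mat_inverse(2)[OF A B] in simp_all)
qed

text \<open>
  This is what makes \<open>g_inverse\<close> the inverse of the map from the times spent with the velocities other
  than \<open>w k\<close> to the position; the times are indexed by \<open>{..<H}\<close> through \<open>insert_index k\<close>.
\<close>

lemma g_inverse_affine:
  assumes w: "affinely_independent_family H {0..H} w" and k: "k \<le> H" and b: "b < H"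
    and y: "\<And>a. a < H \<Longrightarrow> y a = t * w k a + (\<Sum>b<H. difference_matrix w H k $$ (a, b) * z b)"
  shows "g_inverse w H k t y (insert_index k b) = z b"
proof -
  let ?A = "difference_matrix w H k"
  have A: "?A \<in> carrier_mat H H"
    by (simp add: difference_matrix_def)
  obtain B where B: "mat_inverse ?A = Some B" "B \<in> carrier_mat H H" "B * ?A = 1\<^sub>m H"
    by (rule mat_inverse_difference_matrix[OF w k])
  have "Matrix.vec H (\<lambda>a. y a - t * w k a) = ?A *\<^sub>v Matrix.vec H z"
    using A y by (intro eq_vecI) (auto simp: scalar_prod_def atLeast0LessThan)
  then have "B *\<^sub>v Matrix.vec H (\<lambda>a. y a - t * w k a) = (B * ?A) *\<^sub>v Matrix.vec H z"
    using A B(2) by (simp add: assoc_mult_mat_vec)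
  then show ?thesis
    using b by (simp add: g_inverse_def B)
qed

lemma g_inverse_measurable:
  assumes w: "affinely_independent_family H {0..H} w" and k: "k \<le> H" and b: "b < H"
  shows "(\<lambda>y. g_inverse w H k t y (insert_index k b)) \<in> borel_measurable (\<Pi>\<^sub>M a\<in>{..<H}. lborel)"
proof -
  obtain B where B: "mat_inverse (difference_matrix w H k) = Some B" "B \<in> carrier_mat H H"
    by (rule mat_inverse_difference_matrix[OF w k])
  have "g_inverse w H k t y (insert_index k b) = (\<Sum>a<H. B $$ (b, a) * (y a - t * w k a))" for y
    using B b by (simp add: g_inverse_def scalar_prod_def atLeast0LessThan)
  then show ?thesis by simp
qed

text \<open>
  At a point of the simplex, the times given by \<open>g_inverse\<close> are \<open>t\<close> times the barycentric coordinates
  other than the one of index \<open>k\<close>. What remains of \<open>t\<close> is therefore nonnegative. This matters because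
  \<open>count_until\<close> at a negative time is \<open>0\<close>, the supremum of the empty set, which would wrongly count
  as \<open>n\<^sub>k - 1\<close> when \<open>n\<^sub>k = 1\<close>.
\<close>

lemma sum_g_inverse_le:
  fixes u :: "nat \<Rightarrow> real ^ 'd::{finite,linorder}"
  assumes u: "inj_on u {0..H}" "\<not> affine_dependent (u ` {0..H})"
    and t: "0 \<le> t" and k: "k \<le> H"
    and y: "y \<in> hull_projection u H ` (convex hull ((\<lambda>h. t *\<^sub>R u h) ` {0..H}))"
  shows "(\<Sum>b<H. g_inverse (\<lambda>h. hull_projection u H (u h)) H k t y (insert_index k b)) \<le> t"
proof -
  let ?p = "hull_projection u H" and ?w = "\<lambda>h. hull_projection u H (u h)"
  have "convex hull ((\<lambda>h. t *\<^sub>R u h) ` {0..H}) = (*\<^sub>R) t ` (convex hull (u ` {0..H}))"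
    using convex_hull_scaling[of t "u ` {0..H}"] by (simp add: image_image)
  then obtain l where l: "\<forall>x\<in>u ` {0..H}. 0 \<le> l x" "sum l (u ` {0..H}) = 1"
    "y = ?p (t *\<^sub>R (\<Sum>x\<in>u ` {0..H}. l x *\<^sub>R x))"
    using y by (auto simp: convex_hull_finite)
  define c where "c h = l (u h)" for h
  have c: "\<And>h. h \<le> H \<Longrightarrow> 0 \<le> c h" "(\<Sum>h=0..H. c h) = 1" "y = ?p (t *\<^sub>R (\<Sum>h=0..H. c h *\<^sub>R u h))"
    using l u(1) by (auto simp: sum.reindex c_def)
  have ck: "(\<Sum>h=0..H. c h * f h) = f k + (\<Sum>b<H. (f (insert_index k b) - f k) * c (insert_index k b))" for f
  proof -
    have "(\<Sum>h=0..H. c h * f h) = (\<Sum>h=0..H. c h * (f h - f k)) + f k"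
      using c(2) by (simp add: right_diff_distrib sum_subtractf sum_distrib_right[symmetric])
    also have "(\<Sum>h=0..H. c h * (f h - f k)) = (\<Sum>h\<in>{0..H} - {k}. c h * (f h - f k))"
      by (intro sum.mono_neutral_right) auto
    also have "\<dots> = (\<Sum>b<H. c (insert_index k b) * (f (insert_index k b) - f k))"
      by (rule sum.reindex_bij_betw[symmetric, OF bij_betw_insert_index[OF k]])
    finally show ?thesis
      by (simp add: mult.commute)
  qed
  have "g_inverse ?w H k t y (insert_index k b) = t * c (insert_index k b)" if "b < H" for b
  proof (rule g_inverse_affine[OF affinely_independent_hull_projection[OF u] k that])
    fix a assume a: "a < H"
    then have "y a = t * (\<Sum>h=0..H. c h * ?w h a)"
      unfolding c(3) hull_projection_def coordinate_projection_def
      by (simp add: card_first_independent_rows[OF u] sum_component)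
    also have "\<dots> = t * ?w k a + (\<Sum>b<H. difference_matrix ?w H k $$ (a, b) * (t * c (insert_index k b)))"
      unfolding ck[of "\<lambda>h. ?w h a"] using a
      by (simp add: difference_matrix_def distrib_left sum_distrib_left mult_ac)
    finally show "y a = t * ?w k a + (\<Sum>b<H. difference_matrix ?w H k $$ (a, b) * (t * c (insert_index k b)))" .
  qed
  then have "(\<Sum>b<H. g_inverse ?w H k t y (insert_index k b)) = t * (\<Sum>b<H. c (insert_index k b))"
    by (simp add: sum_distrib_left)
  also have "(\<Sum>b<H. c (insert_index k b)) = (\<Sum>h\<in>{0..H} - {k}. c h)"
    by (rule sum.reindex_bij_betw[OF bij_betw_insert_index[OF k]])
  also have "\<dots> \<le> (\<Sum>h=0..H. c h)"
    using c(1) by (intro sum_mono2) auto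
  also have "t * (\<Sum>h=0..H. c h) = t"
    by (simp add: c(2))
  finally show ?thesis
    using t by (simp add: mult_left_mono)
qed

section \<open>Affine change of variables for Lebesgue measure\<close>

text \<open>
  Swaps are reduced to the two other row operations, so that only these have to be treated below.
\<close>

lemma swaprows_as_addrows:
  fixes A :: "real mat"
  assumes "A \<in> carrier_mat n m" "k < n" "l < n" "k \<noteq> l"
  shows "swaprows k l A = multrow l (-1) (addrow 1 k l (addrow (-1) l k (addrow 1 k l A)))"
  using assms by (intro eq_matI) auto

text \<open>
  The elimination algorithm transforms \<open>A\<close> by row operations only. A property that can be pulled back
  along them can thus be pulled back from the result of the algorithm, which for a nonsingular matrix is
  the identity.
\<close>

lemma gauss_jordan_main_row_operation_induct:
  fixes A B :: "real mat"
  assumes add: "\<And>A k l a. A \<in> carrier_mat n n \<Longrightarrow> k < n \<Longrightarrow> l < n \<Longrightarrow> k \<noteq> l \<Longrightarrow>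
      P (addrow a k l A) \<Longrightarrow> P A"
    and mul: "\<And>A k a. A \<in> carrier_mat n n \<Longrightarrow> k < n \<Longrightarrow> a \<noteq> 0 \<Longrightarrow>
      P (multrow k a A) \<Longrightarrow> P A"
  shows "A \<in> carrier_mat n n \<Longrightarrow> P (fst (gauss_jordan_main A B i j)) \<Longrightarrow> P A"
proof (induction A B i j rule: gauss_jordan_main.induct)
  case (1 A B i j)
  have swap: "P A" if A: "A \<in> carrier_mat n n" and kl: "k < n" "l < n" "k \<noteq> l"
    and P: "P (swaprows k l A)" for A k l
  proof -
    have 1: "P (addrow 1 k l (addrow (-1) l k (addrow 1 k l A)))"
      by (rule mul[of _ l "-1"]) (use P A kl swaprows_as_addrows[OF A kl] in auto)
    have 2: "P (addrow (-1) l k (addrow 1 k l A))"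
      by (rule add[of _ k l 1]) (use 1 A kl in auto)
    have 3: "P (addrow 1 k l A)"
      by (rule add[of _ l k "-1"]) (use 2 A kl in auto)
    show ?thesis
      by (rule add[of _ k l 1]) (use 3 A kl in auto)
  qed
  have elim: "P A" if "A \<in> carrier_mat n n" "i < n" "\<forall>(a, k)\<in>set is. k < n \<and> k \<noteq> i"
    "P (eliminate_entries_rec A i is)" for A i and "is" :: "(real \<times> nat) list"
    using that
  proof (induction "is" arbitrary: A)
    case (Cons ak "is")
    obtain a k where ak: "ak = (a, k)" by force
    have "P (addrow a k i A)"
      by (rule Cons.IH) (use Cons.prems ak in auto)
    show ?case
      by (rule add[of A k i a]) (use \<open>P (addrow a k i A)\<close> Cons.prems ak in auto)
  qed simp
  note A = "1.prems"(1)
  then have dim: "n = dim_row A" "n = dim_col A" by auto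
  note IH = "1.IH"[OF dim]
  note res = "1.prems"(2)
  note simp = gauss_jordan_main.simps[of A B i j] Let_def
  show ?case
  proof (cases "i < n \<and> j < n")
    case False
    then show ?thesis using res unfolding simp dim[symmetric] by auto
  next
    case valid: True
    note IH = IH[OF valid refl]
    consider (one) "A $$ (i,j) = 1" | (other) "A $$ (i,j) \<noteq> 0" "A $$ (i,j) \<noteq> 1"
      | (zero) "A $$ (i,j) = 0" by blast
    then show ?thesis
    proof cases
      case one
      let ?E = "\<lambda>B. eliminate_entries (\<lambda>i. A $$ (i,j)) B i j"
      have "P (?E A)"
        by (rule IH(3)) (use res valid one in \<open>auto simp: simp dim[symmetric] carrier_eliminate_entries A\<close>)
      moreover have "?E A = eliminate_entries_rec A i
          (map (\<lambda>i'. (- A $$ (i', j), i')) (filter (\<lambda>i'. i' \<noteq> i) [0 ..< n]))"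
        using eliminate_entries_convert[of j A i A] valid dim by simp
      ultimately have P: "P (eliminate_entries_rec A i
          (map (\<lambda>i'. (- A $$ (i', j), i')) (filter (\<lambda>i'. i' \<noteq> i) [0 ..< n])))"
        by simp
      show ?thesis
        by (rule elim[OF A _ _ P]) (use valid in auto)
    next
      case other
      have P: "P (multrow i (inverse (A $$ (i,j))) A)"
        by (rule IH(4)) (use res valid other A in \<open>auto simp: simp dim[symmetric]\<close>)
      show ?thesis
        by (rule mul[OF A _ _ P]) (use valid other in auto)
    next
      case zero
      let ?is = "[ i' . i' <- [Suc i ..< n],  A $$ (i',j) \<noteq> 0]"
      show ?thesis
      proof (cases ?is)
        case Nil
        show ?thesis
          by (rule IH(1)[OF zero Nil A]) (use res valid zero Nil in \<open>simp add: simp dim[symmetric]\<close>)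
      next
        case (Cons i' iis)
        then have "i' \<in> set ?is" by simp
        then have i': "i' < n" "i \<noteq> i'" by auto
        have P: "P (swaprows i i' A)"
          by (rule IH(2)[OF zero Cons]) (use res valid zero Cons A in \<open>auto simp: simp dim[symmetric]\<close>)
        show ?thesis
          by (rule swap[OF A _ _ _ P]) (use valid i' in auto)
      qed
    qed
  qed
qed

lemma nonsingular_row_operation_induct:
  fixes A :: "real mat"
  assumes A: "A \<in> carrier_mat n n" and det: "Determinant.det A \<noteq> 0"
    and one: "P (1\<^sub>m n)"
    and add: "\<And>A k l a. A \<in> carrier_mat n n \<Longrightarrow> k < n \<Longrightarrow> l < n \<Longrightarrow> k \<noteq> l \<Longrightarrow>
      P (addrow a k l A) \<Longrightarrow> P A"
    and mul: "\<And>A k a. A \<in> carrier_mat n n \<Longrightarrow> k < n \<Longrightarrow> a \<noteq> 0 \<Longrightarrow>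
      P (multrow k a A) \<Longrightarrow> P A"
  shows "P A"
proof -
  have "A \<in> Units (ring_mat TYPE(real) n undefined)"
    by (rule det_non_zero_imp_unit[OF A det])
  then have "fst (gauss_jordan A (1\<^sub>m n)) = 1\<^sub>m n"
    by (rule gauss_jordan_inverse_other_direction) (rule one_carrier_mat)
  then have "P (fst (gauss_jordan_main A (1\<^sub>m n) 0 0))"
    using one by (simp add: gauss_jordan_def)
  from gauss_jordan_main_row_operation_induct[of n P, OF _ _ A this]
  show ?thesis
    using add mul by metis
qed

text \<open>
  An affine change of one coordinate, whose shift may depend on the other coordinates. By Fubini this
  is the one-dimensional substitution rule. Both kinds of row operations act in this way.
\<close>

lemma nn_integral_PiM_coordinate_affine:
  fixes F :: "(nat \<Rightarrow> real) \<Rightarrow> ennreal" and g :: "(nat \<Rightarrow> real) \<Rightarrow> real"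
  assumes F[measurable]: "F \<in> borel_measurable (\<Pi>\<^sub>M a\<in>{..<n}. lborel)"
    and g[measurable]: "g \<in> borel_measurable (\<Pi>\<^sub>M a\<in>{..<n}. lborel)"
    and k: "k < n" and a: "a \<noteq> 0" and gk: "\<And>x z. g (x(k := z)) = g x"
  shows "(\<integral>\<^sup>+x. F x \<partial>(\<Pi>\<^sub>M a\<in>{..<n}. lborel)) =
    ennreal \<bar>a\<bar> * (\<integral>\<^sup>+x. F (x(k := g x + a * x k)) \<partial>(\<Pi>\<^sub>M a\<in>{..<n}. lborel))"
proof -
  interpret product_sigma_finite "\<lambda>_::nat. lborel :: real measure" ..
  \<comment> \<open>The coordinate \<open>k\<close> is integrated first, with the coordinates in \<open>I\<close> held fixed.\<close>
  define I where "I = {..<n} - {k}"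
  have I: "finite I" "k \<notin> I" and n: "{..<n} = insert k I"
    using k by (auto simp: I_def)
  have F'[measurable]: "F \<in> borel_measurable (PiM (insert k I) (\<lambda>_. lborel))"
    and g'[measurable]: "g \<in> borel_measurable (PiM (insert k I) (\<lambda>_. lborel))"
    using F g by (simp_all only: n)
  have upd: "(\<lambda>x. x(k := g x + a * x k)) \<in>
      PiM (insert k I) (\<lambda>_. lborel) \<rightarrow>\<^sub>M PiM (insert k I) (\<lambda>_. lborel)"
    by (rule measurable_fun_upd[where J="insert k I"]) auto
  have *: "(\<lambda>z. F (x(k := z))) \<in> borel_measurable borel"
    if "x \<in> space (PiM I (\<lambda>_. lborel))" for x
  proof -
    have "(\<lambda>z. x(k := z)) \<in> measurable lborel (PiM (insert k I) (\<lambda>_. lborel))"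
      using that I(2) by (rule measurable_component_update)
    from measurable_compose[OF this F'] show ?thesis by simp
  qed
  have "(\<integral>\<^sup>+x. F x \<partial>(PiM (insert k I) (\<lambda>_. lborel))) =
      (\<integral>\<^sup>+x. (\<integral>\<^sup>+z. F (x(k := z)) \<partial>lborel) \<partial>(PiM I (\<lambda>_. lborel)))"
    using I by (rule product_nn_integral_insert) measurable
  also have "\<dots> = (\<integral>\<^sup>+x. ennreal \<bar>a\<bar> * (\<integral>\<^sup>+z. F (x(k := g x + a * z)) \<partial>lborel) \<partial>(PiM I (\<lambda>_. lborel)))"
    using nn_integral_real_affine[OF * a] by (intro nn_integral_cong) simp
  also have "\<dots> = ennreal \<bar>a\<bar> * (\<integral>\<^sup>+x. (\<integral>\<^sup>+z. F (x(k := g x + a * z)) \<partial>lborel) \<partial>(PiM I (\<lambda>_. lborel)))"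
  proof (rule nn_integral_cmult)
    have "(\<lambda>p. (\<lambda>(x, z). x(k := z)) p) \<in>
        PiM I (\<lambda>_. lborel) \<Otimes>\<^sub>M lborel \<rightarrow>\<^sub>M PiM (insert k I) (\<lambda>_. lborel)"
      by (rule measurable_add_dim)
    from measurable_compose[OF measurable_compose[OF this upd] F']
    have "(\<lambda>p. F ((fst p)(k := g (fst p) + a * snd p))) \<in>
       borel_measurable (PiM I (\<lambda>_. lborel) \<Otimes>\<^sub>M lborel)"
      by (simp add: gk case_prod_beta)
    then show "(\<lambda>x. \<integral>\<^sup>+z. F (x(k := g x + a * z)) \<partial>lborel) \<in> borel_measurable (PiM I (\<lambda>_. lborel))"
      by (intro lborel.borel_measurable_nn_integral) (simp add: case_prod_beta)
  qed
  also have "(\<integral>\<^sup>+x. (\<integral>\<^sup>+z. F (x(k := g x + a * z)) \<partial>lborel) \<partial>(PiM I (\<lambda>_. lborel))) =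
      (\<integral>\<^sup>+x. F (x(k := g x + a * x k)) \<partial>(PiM (insert k I) (\<lambda>_. lborel)))"
  proof (subst product_nn_integral_insert[OF I])
    show "(\<lambda>x. F (x(k := g x + a * x k))) \<in> borel_measurable (PiM (insert k I) (\<lambda>_. lborel))"
      by (rule measurable_compose[OF upd F'])
  qed (simp add: gk)
  finally show ?thesis unfolding n .
qed

lemma nn_integral_PiM_translation:
  fixes F :: "(nat \<Rightarrow> real) \<Rightarrow> ennreal"
  assumes F[measurable]: "F \<in> borel_measurable (\<Pi>\<^sub>M a\<in>{..<n}. lborel)"
  shows "(\<integral>\<^sup>+x. F x \<partial>(\<Pi>\<^sub>M a\<in>{..<n}. lborel)) =
    (\<integral>\<^sup>+x. F (\<lambda>a\<in>{..<n}. c a + x a) \<partial>(\<Pi>\<^sub>M a\<in>{..<n}. lborel))"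
proof -
  let ?L = "\<Pi>\<^sub>M a\<in>{..<n}. lborel :: real measure"
  interpret product_sigma_finite "\<lambda>_::nat. lborel :: real measure" ..
  have T[measurable]: "(\<lambda>x. \<lambda>a\<in>{..<n}. c a + x a) \<in> ?L \<rightarrow>\<^sub>M ?L"
    by measurable
  have "distr ?L ?L (\<lambda>x. \<lambda>a\<in>{..<n}. c a + x a) = ?L"
  proof (rule PiM_eqI)
    fix A :: "nat \<Rightarrow> real set" assume A: "\<And>i. i \<in> {..<n} \<Longrightarrow> A i \<in> sets lborel"
    have "(\<lambda>x. \<lambda>a\<in>{..<n}. c a + x a) -` Pi\<^sub>E {..<n} A \<inter> space ?L =
        Pi\<^sub>E {..<n} (\<lambda>a. (+) (c a) -` A a)"
      by (auto simp: space_PiM PiE_def Pi_def)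
    then have "emeasure (distr ?L ?L (\<lambda>x. \<lambda>a\<in>{..<n}. c a + x a)) (Pi\<^sub>E {..<n} A) =
        emeasure ?L (Pi\<^sub>E {..<n} (\<lambda>a. (+) (c a) -` A a))"
      using A by (subst emeasure_distr) auto
    also have "\<dots> = (\<Prod>a<n. emeasure lborel ((+) (c a) -` A a))"
    proof (rule emeasure_PiM)
      fix i assume "i \<in> {..<n}"
      then show "(+) (c i) -` A i \<in> sets lborel"
        using A[of i] measurable_sets[of "(+) (c i)" borel borel "A i"] by simp
    qed simp
    also have "\<dots> = (\<Prod>a<n. emeasure lborel (A a))"
    proof (rule prod.cong)
      fix i assume i: "i \<in> {..<n}"
      have "emeasure lborel (A i) = emeasure (distr lborel borel ((+) (c i))) (A i)"
        by (simp add: lborel_distr_plus)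
      then show "emeasure lborel ((+) (c i) -` A i) = emeasure lborel (A i)"
        using A[OF i] by (simp add: emeasure_distr)
    qed simp
    finally show "emeasure (distr ?L ?L (\<lambda>x. \<lambda>a\<in>{..<n}. c a + x a)) (Pi\<^sub>E {..<n} A) =
      (\<Prod>a<n. emeasure lborel (A a))" .
  qed simp_all
  then have "(\<integral>\<^sup>+x. F x \<partial>?L) = (\<integral>\<^sup>+x. F x \<partial>(distr ?L ?L (\<lambda>x. \<lambda>a\<in>{..<n}. c a + x a)))"
    by simp
  also have "\<dots> = (\<integral>\<^sup>+x. F (\<lambda>a\<in>{..<n}. c a + x a) \<partial>?L)"
    by (rule nn_integral_distr) measurable
  finally show ?thesis .
qed

text \<open>
  The dimension is a natural number here and not the cardinality of a type, so the substitution rule is proved for products indexed by \<open>{..<n}\<close>.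
  The statement is generalised over the shift \<open>c\<close> because a row operation applied to \<open>A x + c\<close> also
  changes \<open>c\<close>; the identity matrix leaves a translation.
\<close>

theorem nn_integral_PiM_affine:
  fixes F :: "(nat \<Rightarrow> real) \<Rightarrow> ennreal"
  assumes A: "A \<in> carrier_mat n n" and det: "Determinant.det A \<noteq> 0"
    and F: "F \<in> borel_measurable (\<Pi>\<^sub>M a\<in>{..<n}. lborel)"
  shows "(\<integral>\<^sup>+x. F x \<partial>(\<Pi>\<^sub>M a\<in>{..<n}. lborel)) = ennreal \<bar>Determinant.det A\<bar> *
    (\<integral>\<^sup>+x. F (\<lambda>a\<in>{..<n}. c a + (\<Sum>b<n. A $$ (a, b) * x b)) \<partial>(\<Pi>\<^sub>M a\<in>{..<n}. lborel))"
proof -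
  let ?L = "\<Pi>\<^sub>M a\<in>{..<n}. lborel :: real measure"
  let ?P = "\<lambda>A. \<forall>F\<in>borel_measurable ?L. \<forall>c. (\<integral>\<^sup>+x. F x \<partial>?L) = ennreal \<bar>Determinant.det A\<bar> *
    (\<integral>\<^sup>+x. F (\<lambda>a\<in>{..<n}. c a + (\<Sum>b<n. A $$ (a, b) * x b)) \<partial>?L)"
  have "?P A"
    using A det
  proof (rule nonsingular_row_operation_induct)
    show "?P (1\<^sub>m n)"
    proof (intro ballI allI)
      fix F :: "(nat \<Rightarrow> real) \<Rightarrow> ennreal" and c
      assume F: "F \<in> borel_measurable ?L"
      have "(\<lambda>a\<in>{..<n}. c a + (\<Sum>b<n. 1\<^sub>m n $$ (a, b) * x b)) = (\<lambda>a\<in>{..<n}. c a + x a)"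
        for x :: "nat \<Rightarrow> real"
      proof (rule restrict_ext)
        fix a assume "a \<in> {..<n}"
        then have "(\<Sum>b<n. 1\<^sub>m n $$ (a, b) * x b) = (\<Sum>b<n. if a = b then x b else 0)"
          by (intro sum.cong) auto
        then show "c a + (\<Sum>b<n. 1\<^sub>m n $$ (a, b) * x b) = c a + x a"
          using \<open>a \<in> {..<n}\<close> by simp
      qed
      then show "(\<integral>\<^sup>+x. F x \<partial>?L) = ennreal \<bar>Determinant.det (1\<^sub>m n :: real mat)\<bar> *
          (\<integral>\<^sup>+x. F (\<lambda>a\<in>{..<n}. c a + (\<Sum>b<n. 1\<^sub>m n $$ (a, b) * x b)) \<partial>?L)"
        using nn_integral_PiM_translation[OF F, of c] by simp
    qed
  next
    fix A :: "real mat" and k l :: nat and a :: real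
    assume A: "A \<in> carrier_mat n n" and k: "k < n" and l: "l < n" and kl: "k \<noteq> l"
      and P: "?P (addrow a k l A)"
    show "?P A"
    proof (intro ballI allI)
      fix F :: "(nat \<Rightarrow> real) \<Rightarrow> ennreal" and c :: "nat \<Rightarrow> real"
      assume F[measurable]: "F \<in> borel_measurable ?L"
      \<comment> \<open>\<open>G\<close> undoes the row operation before applying \<open>F\<close>.\<close>
      define G where "G y = F (y(k := - a * y l + 1 * y k))" for y
      have upd: "(\<lambda>y. y(k := - a * y l + 1 * y k)) \<in> ?L \<rightarrow>\<^sub>M ?L"
        using k l by (intro measurable_fun_upd[where J="{..<n}"]) auto
      have G: "G \<in> borel_measurable ?L"
        unfolding G_def by (rule measurable_compose[OF upd F])
      have "(\<integral>\<^sup>+x. F x \<partial>?L) = (\<integral>\<^sup>+x. G x \<partial>?L)"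
        unfolding G_def using kl k l
        by (subst nn_integral_PiM_coordinate_affine[OF F, of "\<lambda>y. - a * y l" k 1]) auto
      also have "\<dots> = ennreal \<bar>Determinant.det (addrow a k l A)\<bar> * (\<integral>\<^sup>+x. G (\<lambda>i\<in>{..<n}.
          (c(k := c k + a * c l)) i + (\<Sum>b<n. (addrow a k l A) $$ (i, b) * x b)) \<partial>?L)"
        using P G by blast
      also have "Determinant.det (addrow a k l A) = Determinant.det A"
        by (rule det_addrow[OF l kl A])
      also have "(\<lambda>x. G (\<lambda>i\<in>{..<n}.
            (c(k := c k + a * c l)) i + (\<Sum>b<n. (addrow a k l A) $$ (i, b) * x b))) =
          (\<lambda>x. F (\<lambda>a\<in>{..<n}. c a + (\<Sum>b<n. A $$ (a, b) * x b)))"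
        unfolding G_def using A k l kl
        by (intro ext arg_cong[where f=F])
           (auto simp: algebra_simps sum.distrib sum_distrib_left sum_negf)
      finally show "(\<integral>\<^sup>+x. F x \<partial>?L) = ennreal \<bar>Determinant.det A\<bar> *
          (\<integral>\<^sup>+x. F (\<lambda>a\<in>{..<n}. c a + (\<Sum>b<n. A $$ (a, b) * x b)) \<partial>?L)" .
    qed
  next
    fix A :: "real mat" and k :: nat and a :: real
    assume A: "A \<in> carrier_mat n n" and k: "k < n" and a: "a \<noteq> 0"
      and P: "?P (multrow k a A)"
    show "?P A"
    proof (intro ballI allI)
      fix F :: "(nat \<Rightarrow> real) \<Rightarrow> ennreal" and c :: "nat \<Rightarrow> real"
      assume F[measurable]: "F \<in> borel_measurable ?L"
      define G where "G y = F (y(k := 0 + inverse a * y k))" for y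
      have upd: "(\<lambda>y. y(k := 0 + inverse a * y k)) \<in> ?L \<rightarrow>\<^sub>M ?L"
        using k by (intro measurable_fun_upd[where J="{..<n}"]) auto
      have G: "G \<in> borel_measurable ?L"
        unfolding G_def by (rule measurable_compose[OF upd F])
      have "(\<integral>\<^sup>+x. F x \<partial>?L) = ennreal \<bar>inverse a\<bar> * (\<integral>\<^sup>+x. G x \<partial>?L)"
        unfolding G_def using k a
        by (subst nn_integral_PiM_coordinate_affine[OF F, of "\<lambda>_. 0" k "inverse a"]) auto
      also have "(\<integral>\<^sup>+x. G x \<partial>?L) = ennreal \<bar>Determinant.det (multrow k a A)\<bar> * (\<integral>\<^sup>+x. G (\<lambda>i\<in>{..<n}.
          (c(k := a * c k)) i + (\<Sum>b<n. (multrow k a A) $$ (i, b) * x b)) \<partial>?L)"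
        using P G by blast
      also have "Determinant.det (multrow k a A) = a * Determinant.det A"
        by (rule det_multrow[OF k A])
      also have "(\<lambda>x. G (\<lambda>i\<in>{..<n}.
            (c(k := a * c k)) i + (\<Sum>b<n. (multrow k a A) $$ (i, b) * x b))) =
          (\<lambda>x. F (\<lambda>a\<in>{..<n}. c a + (\<Sum>b<n. A $$ (a, b) * x b)))"
      proof (intro ext)
        fix x
        have "(\<Sum>b<n. (multrow k a A) $$ (k, b) * x b) = a * (\<Sum>b<n. A $$ (k, b) * x b)"
          using A k by (simp add: sum_distrib_left mult.assoc)
        moreover have "(\<Sum>b<n. (multrow k a A) $$ (i, b) * x b) = (\<Sum>b<n. A $$ (i, b) * x b)"
          if "i < n" "i \<noteq> k" for i
          using A that by simp
        ultimately show "G (\<lambda>i\<in>{..<n}. (c(k := a * c k)) i +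
              (\<Sum>b<n. (multrow k a A) $$ (i, b) * x b)) =
            F (\<lambda>a\<in>{..<n}. c a + (\<Sum>b<n. A $$ (a, b) * x b))"
          unfolding G_def using k a
          by (intro arg_cong[where f=F] ext) (simp add: distrib_left[symmetric] mult.assoc[symmetric])
      qed
      finally have "(\<integral>\<^sup>+x. F x \<partial>?L) = (ennreal \<bar>inverse a\<bar> * ennreal \<bar>a * Determinant.det A\<bar>) *
          (\<integral>\<^sup>+x. F (\<lambda>a\<in>{..<n}. c a + (\<Sum>b<n. A $$ (a, b) * x b)) \<partial>?L)"
        by (simp only: mult.assoc)
      also have "ennreal \<bar>inverse a\<bar> * ennreal \<bar>a * Determinant.det A\<bar> = ennreal \<bar>Determinant.det A\<bar>"
        using a by (simp add: ennreal_mult[symmetric] abs_mult)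
      finally show "(\<integral>\<^sup>+x. F x \<partial>?L) = ennreal \<bar>Determinant.det A\<bar> *
          (\<integral>\<^sup>+x. F (\<lambda>a\<in>{..<n}. c a + (\<Sum>b<n. A $$ (a, b) * x b)) \<partial>?L)" .
    qed
  qed
  then show ?thesis
    using F by blast
qed

section \<open>Independence and densities\<close>

text \<open>
  Both measures are compared with the product of the marginal laws on boxes. The family of marginal laws
  is extended by \<open>lborel\<close> outside \<open>{..<n}\<close> only to make all of its members sigma-finite.
\<close>

lemma (in prob_space) distr_indep_density:
  fixes Y :: "nat \<Rightarrow> 'a \<Rightarrow> real"
  assumes indep: "indep_vars (\<lambda>_. lborel) Y {..<n}"
    and dens: "\<And>b. b < n \<Longrightarrow> distributed M lborel (Y b) (g b)"
  shows "distr M (\<Pi>\<^sub>M b\<in>{..<n}. lborel) (\<lambda>\<omega>. \<lambda>b\<in>{..<n}. Y b \<omega>) =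
    density (\<Pi>\<^sub>M b\<in>{..<n}. lborel) (\<lambda>z. \<Prod>b<n. g b (z b))"
proof -
  let ?L = "\<Pi>\<^sub>M b\<in>{..<n}. lborel :: real measure"
  define N where "N b = (if b < n then distr M lborel (Y b) else lborel)" for b
  have Y[measurable]: "Y b \<in> M \<rightarrow>\<^sub>M lborel" if "b < n" for b
    using dens[OF that] by (simp add: distributed_def)
  have g[measurable]: "g b \<in> borel_measurable lborel" if "b < n" for b
    using dens[OF that] by (simp add: distributed_def)
  have "sigma_finite_measure (N b)" for b
  proof (cases "b < n")
    case True
    interpret D: prob_space "distr M lborel (Y b)"
      using Y[OF True] by (rule prob_space_distr)
    show ?thesis
      using True by (simp add: N_def D.sigma_finite_measure_axioms)
  qed (simp add: N_def lborel.sigma_finite_measure_axioms)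
  then interpret N: product_sigma_finite N
    by (simp add: product_sigma_finite_def)
  interpret L: product_sigma_finite "\<lambda>_::nat. lborel :: real measure" ..
  have sets: "sets ?L = sets (PiM {..<n} N)"
    by (intro sets_PiM_cong) (simp_all add: N_def)
  have "distr M ?L (\<lambda>\<omega>. \<lambda>b\<in>{..<n}. Y b \<omega>) = PiM {..<n} N"
  proof (rule N.PiM_eqI)
    fix A assume "\<And>b. b \<in> {..<n} \<Longrightarrow> A b \<in> sets (N b)"
    then have A: "A b \<in> sets lborel" if "b < n" for b
      using that by (simp add: N_def)
    have N: "emeasure (N b) (A b) = prob (Y b -` A b \<inter> space M)" if "b < n" for b
      using that A[OF that] by (simp add: N_def emeasure_distr[OF Y[OF that]] emeasure_eq_measure)
    have meas: "(\<lambda>\<omega>. \<lambda>b\<in>{..<n}. Y b \<omega>) \<in> M \<rightarrow>\<^sub>M ?L"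
      by (rule measurable_restrict, rule Y) simp
    have PA: "Pi\<^sub>E {..<n} A \<in> sets ?L"
      using A by (intro sets_PiM_I_finite) auto
    have "emeasure (distr M ?L (\<lambda>\<omega>. \<lambda>b\<in>{..<n}. Y b \<omega>)) (Pi\<^sub>E {..<n} A) =
        prob ((\<lambda>\<omega>. \<lambda>b\<in>{..<n}. Y b \<omega>) -` Pi\<^sub>E {..<n} A \<inter> space M)"
      using meas PA by (simp add: emeasure_distr emeasure_eq_measure)
    also have "\<dots> = (\<Prod>b<n. prob (Y b -` A b \<inter> space M))"
    proof (cases "n = 0")
      case True
      then show ?thesis
        by (simp add: PiE_def prob_space vimage_def extensional_def restrict_def)
    next
      case False
      then have "(\<lambda>\<omega>. \<lambda>b\<in>{..<n}. Y b \<omega>) -` Pi\<^sub>E {..<n} A \<inter> space M = (\<Inter>b\<in>{..<n}. Y b -` A b \<inter> space M)"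
        by (auto simp: PiE_iff)
      then show ?thesis
        using False A indep_varsD[OF indep, of "{..<n}" A] by auto
    qed
    also have "\<dots> = (\<Prod>b<n. emeasure (N b) (A b))"
      by (simp add: N prod_ennreal)
    finally show "emeasure (distr M ?L (\<lambda>\<omega>. \<lambda>b\<in>{..<n}. Y b \<omega>)) (Pi\<^sub>E {..<n} A) =
      (\<Prod>b<n. emeasure (N b) (A b))" .
  qed (simp_all add: sets)
  also have "PiM {..<n} N = density ?L (\<lambda>z. \<Prod>b<n. g b (z b))"
  proof (rule N.PiM_eqI[symmetric])
    fix A assume "\<And>b. b \<in> {..<n} \<Longrightarrow> A b \<in> sets (N b)"
    then have A[measurable]: "A b \<in> sets lborel" if "b < n" for b
      using that by (simp add: N_def)
    have PA: "Pi\<^sub>E {..<n} A \<in> sets ?L"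
      using A by (intro sets_PiM_I_finite) auto
    have "(\<lambda>z. \<Prod>b<n. g b (z b)) \<in> borel_measurable ?L"
    proof (rule borel_measurable_prod_ennreal)
      fix b assume b: "b \<in> {..<n}"
      show "(\<lambda>z. g b (z b)) \<in> borel_measurable ?L"
        by (rule measurable_compose[OF measurable_component_singleton[OF b] g]) (use b in simp)
    qed
    then have "emeasure (density ?L (\<lambda>z. \<Prod>b<n. g b (z b))) (Pi\<^sub>E {..<n} A) =
        (\<integral>\<^sup>+z. (\<Prod>b<n. g b (z b)) * indicator (Pi\<^sub>E {..<n} A) z \<partial>?L)"
      using PA by (rule emeasure_density)
    also have "\<dots> = (\<integral>\<^sup>+z. (\<Prod>b<n. g b (z b) * indicator (A b) (z b)) \<partial>?L)"
    proof (rule nn_integral_cong)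
      fix z assume "z \<in> space ?L"
      then have "indicator (Pi\<^sub>E {..<n} A) z = (\<Prod>b<n. indicator (A b) (z b) :: ennreal)"
        by (auto simp: space_PiM PiE_iff indicator_def prod.neutral prod_zero_iff[symmetric]
            intro!: prod_zero[symmetric])
      then show "(\<Prod>b<n. g b (z b)) * indicator (Pi\<^sub>E {..<n} A) z =
          (\<Prod>b<n. g b (z b) * indicator (A b) (z b))"
        by (simp add: prod.distrib)
    qed
    also have "\<dots> = (\<Prod>b<n. \<integral>\<^sup>+x. g b x * indicator (A b) x \<partial>lborel)"
      by (rule L.product_nn_integral_prod) simp_all
    also have "\<dots> = (\<Prod>b<n. emeasure (N b) (A b))"
    proof (rule prod.cong)
      fix b assume "b \<in> {..<n}"
      then have b: "b < n" by simp
      show "(\<integral>\<^sup>+x. g b x * indicator (A b) x \<partial>lborel) = emeasure (N b) (A b)"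
        using b distributed_distr_eq_density[OF dens[OF b]] emeasure_density[OF g[OF b] A[OF b]]
        by (simp add: N_def)
    qed simp
    finally show "emeasure (density ?L (\<lambda>z. \<Prod>b<n. g b (z b))) (Pi\<^sub>E {..<n} A) =
      (\<Prod>b<n. emeasure (N b) (A b))" .
  qed (simp_all add: sets)
  finally show ?thesis .
qed

text \<open>
  By independence the joint law is the product of the marginal laws, so this is Fubini's theorem.
\<close>

lemma (in prob_space) emeasure_indep_var:
  assumes indep: "indep_var S X T Y" and Q: "Q \<in> sets (S \<Otimes>\<^sub>M T)"
  shows "emeasure M {\<omega> \<in> space M. (X \<omega>, Y \<omega>) \<in> Q} =
    (\<integral>\<^sup>+x. emeasure M {\<omega> \<in> space M. (x, Y \<omega>) \<in> Q} \<partial>distr M S X)"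
proof -
  have rv[measurable]: "X \<in> M \<rightarrow>\<^sub>M S" "Y \<in> M \<rightarrow>\<^sub>M T"
    and eq: "distr M S X \<Otimes>\<^sub>M distr M T Y = distr M (S \<Otimes>\<^sub>M T) (\<lambda>\<omega>. (X \<omega>, Y \<omega>))"
    using indep unfolding indep_var_distribution_eq by auto
  interpret T: prob_space "distr M T Y"
    by (rule prob_space_distr) simp
  have Q': "Q \<in> sets (distr M S X \<Otimes>\<^sub>M distr M T Y)"
    using Q by (simp cong: sets_pair_measure_cong)
  have "emeasure M {\<omega> \<in> space M. (X \<omega>, Y \<omega>) \<in> Q} =
      emeasure (distr M (S \<Otimes>\<^sub>M T) (\<lambda>\<omega>. (X \<omega>, Y \<omega>))) Q"
    using Q by (subst emeasure_distr) (auto intro!: arg_cong[where f="emeasure M"])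
  also have "\<dots> = (\<integral>\<^sup>+x. emeasure (distr M T Y) (Pair x -` Q) \<partial>distr M S X)"
    unfolding eq[symmetric] using Q' by (rule T.emeasure_pair_measure_alt)
  also have "\<dots> = (\<integral>\<^sup>+x. emeasure M {\<omega> \<in> space M. (x, Y \<omega>) \<in> Q} \<partial>distr M S X)"
  proof (rule nn_integral_cong)
    fix x
    have "Pair x -` Q \<in> sets T"
      using Q by (rule sets_Pair1)
    then show "emeasure (distr M T Y) (Pair x -` Q) = emeasure M {\<omega> \<in> space M. (x, Y \<omega>) \<in> Q}"
      by (subst emeasure_distr) (auto intro!: arg_cong[where f="emeasure M"])
  qed
  finally show ?thesis .
qed

text \<open>
  The supremum over a random set is rewritten as one over all indices, with value \<open>0\<close> at those outside
  the set.
\<close>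

lemma measurable_count_until:
  assumes [measurable]: "\<And>n. S n \<in> borel_measurable N" "s \<in> borel_measurable N"
  shows "(\<lambda>x. count_until (\<lambda>n. S n x) (s x)) \<in> N \<rightarrow>\<^sub>M count_space UNIV"
proof -
  have eq: "count_until T r = (SUP n. if T n \<le> r then enat n else 0)" for T r
    unfolding count_until_def
  proof (rule antisym)
    show "Sup (enat ` {n. T n \<le> r}) \<le> (SUP n. if T n \<le> r then enat n else 0)"
    proof (rule Sup_least)
      fix x assume "x \<in> enat ` {n. T n \<le> r}"
      then obtain n where "x = enat n" "T n \<le> r"
        by auto
      then show "x \<le> (SUP n. if T n \<le> r then enat n else 0)"
        using SUP_upper[of n UNIV "\<lambda>n. if T n \<le> r then enat n else 0"] by simp
    qed
    show "(SUP n. if T n \<le> r then enat n else 0) \<le> Sup (enat ` {n. T n \<le> r})"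
      by (rule SUP_least) (auto intro: Sup_upper)
  qed
  show ?thesis
    unfolding eq by measurable
qed

lemma (in prob_space) measurable_prob_count_until:
  assumes [measurable]: "\<And>n. S n \<in> borel_measurable M"
  shows "(\<lambda>r. emeasure M {\<omega> \<in> space M. count_until (\<lambda>n. S n \<omega>) r = m}) \<in> borel_measurable borel"
proof -
  let ?Q = "{x \<in> space (borel \<Otimes>\<^sub>M M). count_until (\<lambda>n. S n (snd x)) (fst x) = m}"
  have "(\<lambda>x. count_until (\<lambda>n. S n (snd x)) (fst x)) \<in> borel \<Otimes>\<^sub>M M \<rightarrow>\<^sub>M count_space UNIV"
    by (rule measurable_count_until) simp_all
  then have "?Q \<in> sets (borel \<Otimes>\<^sub>M M)"
    by measurable
  then have "(\<lambda>r. emeasure M (Pair r -` ?Q)) \<in> borel_measurable borel"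
    by (rule measurable_emeasure_Pair)
  moreover have "Pair r -` ?Q = {\<omega> \<in> space M. count_until (\<lambda>n. S n \<omega>) r = m}" for r
    by (auto simp: space_pair_measure)
  ultimately show ?thesis by simp
qed

lemma measurable_of_subalgebra:
  "f \<in> F \<rightarrow>\<^sub>M N \<Longrightarrow> space F = space M \<Longrightarrow> sets F \<subseteq> sets M \<Longrightarrow> f \<in> M \<rightarrow>\<^sub>M N"
  by (auto simp: measurable_def)

lemma measurable_partial_sum_component:
  assumes "h \<in> J"
  shows "(\<lambda>\<xi>. \<Sum>j=1..m. \<xi> h j) \<in> PiM J (\<lambda>_. PiM {1::nat..} (\<lambda>_. borel :: real measure)) \<rightarrow>\<^sub>M lborel"
proof -
  have "(\<lambda>\<xi>. \<xi> h j) \<in> borel_measurable (PiM J (\<lambda>_. PiM {1::nat..} (\<lambda>_. borel :: real measure)))"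
    if "j \<in> {1..m}" for j
  proof -
    have "(\<lambda>\<xi>. \<xi> h) \<in> PiM J (\<lambda>_. PiM {1::nat..} (\<lambda>_. borel :: real measure)) \<rightarrow>\<^sub>M PiM {1..} (\<lambda>_. borel)"
      using assms by (rule measurable_component_singleton)
    moreover have "(\<lambda>x. x j) \<in> PiM {1::nat..} (\<lambda>_. borel :: real measure) \<rightarrow>\<^sub>M borel"
      using that by (intro measurable_component_singleton) simp
    ultimately show ?thesis
      by (rule measurable_compose)
  qed
  then have "(\<lambda>\<xi>. \<Sum>j=1..m. \<xi> h j) \<in>
      borel_measurable (PiM J (\<lambda>_. PiM {1::nat..} (\<lambda>_. borel :: real measure)))"
    by (rule borel_measurable_sum)
  then show ?thesis by simp
qed

lemma (in minimal_random_motion) selected_velocities_affine_independent: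
  assumes "inj_on i {0..H}" "i ` {0..H} \<subseteq> {0..CARD('d)}"
  shows "inj_on (\<lambda>h. v (i h)) {0..H}" and "\<not> affine_dependent ((\<lambda>h. v (i h)) ` {0..H})"
proof -
  have "inj_on v (i ` {0..H})"
    using v_inj assms(2) by (rule inj_on_subset)
  then show "inj_on (\<lambda>h. v (i h)) {0..H}"
    using comp_inj_on[OF assms(1)] by (simp add: comp_def)
  have "(\<lambda>h. v (i h)) ` {0..H} \<subseteq> v ` {0..CARD('d)}"
    using assms(2) by auto
  then show "\<not> affine_dependent ((\<lambda>h. v (i h)) ` {0..H})"
    using v_affine_indep affine_independent_subset by blast
qed

section \<open>Paths of the motion\<close>

lemma count_until_eq_iff:
  assumes S: "\<And>n. S n \<le> S (Suc n)" and S0: "S 0 \<le> s"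
  shows "count_until S s = enat m \<longleftrightarrow> S m \<le> s \<and> s < S (Suc m)"
proof -
  let ?A = "{n. S n \<le> s}"
  have mono: "S a \<le> S b" if "a \<le> b" for a b
    using that by (rule lift_Suc_mono_le[of S, OF S])
  show ?thesis
  proof
    assume c: "count_until S s = enat m"
    have ne: "enat ` ?A \<noteq> {}"
      using S0 by blast
    with c have fin: "finite (enat ` ?A)" and max: "Max (enat ` ?A) = enat m"
      unfolding count_until_def Sup_enat_def by (auto split: if_splits)
    from Max_in[OF fin ne] have "S m \<le> s"
      unfolding max by auto
    moreover have "\<not> S (Suc m) \<le> s"
    proof
      assume "S (Suc m) \<le> s"
      then have "enat (Suc m) \<le> Max (enat ` ?A)"
        using fin by (intro Max_ge) auto
      then show False
        unfolding max by simp
    qed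
    ultimately show "S m \<le> s \<and> s < S (Suc m)" by simp
  next
    assume m: "S m \<le> s \<and> s < S (Suc m)"
    have "?A = {..m}"
    proof (intro equalityI subsetI)
      fix n assume "n \<in> ?A"
      then have "\<not> Suc m \<le> n"
        using m mono[of "Suc m" n] by auto
      then show "n \<in> {..m}" by simp
    next
      fix n assume "n \<in> {..m}"
      then show "n \<in> ?A"
        using m mono[of n m] by auto
    qed
    moreover have "Max (enat ` {..m}) = enat m"
      by (rule Max_eqI) auto
    ultimately show "count_until S s = enat m"
      unfolding count_until_def Sup_enat_def by auto
  qed
qed

text \<open>
  The function is \<open>c j\<close> on \<open>{T j..<T (Suc j)}\<close>. Intervals of length zero are allowed; the right end point
  of each interval is exceptional.
\<close>

lemma has_integral_piecewise_constant:
  fixes f :: "real \<Rightarrow> 'b::euclidean_space"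
  assumes T: "\<And>n. T n \<le> T (Suc n)" and T0: "T 0 = 0"
    and f: "\<And>s. 0 \<le> s \<Longrightarrow> f s = c (the_enat (count_until T s))"
    and m: "T m \<le> t" "t < T (Suc m)"
  shows "(f has_integral (\<Sum>j<m. (T (Suc j) - T j) *\<^sub>R c j) + (t - T m) *\<^sub>R c m) {0..t}"
proof -
  have T_nonneg: "0 \<le> T n" for n
    using lift_Suc_mono_le[of T 0 n, OF T] T0 by simp
  have piece: "(f has_integral (b - T j) *\<^sub>R c j) {T j..b}" if b: "T j \<le> b" "b \<le> T (Suc j)" for j b
  proof (rule has_integral_spike_finite[of "{b}"])
    fix s assume "s \<in> {T j..b} - {b}"
    then have s: "T j \<le> s" "s < T (Suc j)"
      using b by auto
    then have "count_until T s = enat j"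
      using count_until_eq_iff[of T s j, OF T] T_nonneg[of j] T0 by auto
    then show "f s = c j"
      using f[of s] s(1) T_nonneg[of j] by simp
  next
    show "((\<lambda>_. c j) has_integral (b - T j) *\<^sub>R c j) {T j..b}"
      using has_integral_const_real[of "c j" "T j" b] b(1) by simp
  qed simp
  have "(f has_integral (\<Sum>j<m. (T (Suc j) - T j) *\<^sub>R c j)) {0..T m}"
  proof (induction m)
    case (Suc m)
    have "(f has_integral (\<Sum>j<m. (T (Suc j) - T j) *\<^sub>R c j) + (T (Suc m) - T m) *\<^sub>R c m) {0..T (Suc m)}"
      by (rule has_integral_combine[OF T_nonneg[of m] T Suc.IH piece]) (use T in auto)
    then show ?case by simp
  qed (use has_integral_refl(1)[of f 0] in \<open>simp add: T0\<close>)
  from has_integral_combine[OF T_nonneg[of m] m(1) this piece] m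
  show ?thesis by simp
qed

lemma arrival_time_Suc: "arrival_time W (Suc n) \<omega> = arrival_time W n \<omega> + W (Suc n) \<omega>"
  by (simp add: arrival_time_def)

text \<open>
  The step \<open>j\<close> lasts as long as the displacement of the same rank among those with its velocity, so a sum
  over the first \<open>m\<close> steps can be grouped by velocity, and each group is an initial segment. With \<open>G\<close>
  constant this computes the time of the \<open>m\<close>-th event, with \<open>G\<close> the identity the position at that time.
\<close>

lemma sum_durations_by_velocity:
  fixes W :: "nat \<Rightarrow> 'a \<Rightarrow> real" and G :: "'v \<Rightarrow> 'b::real_vector"
  assumes v: "inj_on v {0..d}"
    and range: "\<And>n. step_velocity W V n \<omega> \<in> v ` {0..d}"
    and dur: "\<And>n h. h \<le> d \<Longrightarrow> step_velocity W V n \<omega> = v h \<Longrightarrow>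
      W (Suc n) \<omega> = Wd h (selections W V (v h) (Suc n) \<omega>) \<omega>"
  shows "(\<Sum>j<m. W (Suc j) \<omega> *\<^sub>R G (step_velocity W V j \<omega>)) =
    (\<Sum>h=0..d. duration_sum Wd h (selections W V (v h) m \<omega>) \<omega> *\<^sub>R G (v h))"
proof (induction m)
  case 0
  show ?case
    by (simp add: selections_def duration_sum_def)
next
  case (Suc m)
  let ?s = "\<lambda>h m. selections W V (v h) m \<omega>"
  obtain g where g: "g \<le> d" "step_velocity W V m \<omega> = v g"
    using range[of m] by auto
  have sel: "?s h (Suc m) = (if h = g then Suc (?s h m) else ?s h m)" if "h \<le> d" for h
  proof -
    have "v g = v h \<longleftrightarrow> h = g"
      using v g(1) that by (auto dest: inj_onD)
    moreover have "{j. j < Suc m \<and> step_velocity W V j \<omega> = v h} =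
        (if step_velocity W V m \<omega> = v h then insert m else id) {j. j < m \<and> step_velocity W V j \<omega> = v h}"
      by (auto simp: less_Suc_eq)
    ultimately show ?thesis
      using g by (simp add: selections_def)
  qed
  have "(\<Sum>h=0..d. duration_sum Wd h (?s h (Suc m)) \<omega> *\<^sub>R G (v h)) =
      (\<Sum>h=0..d. duration_sum Wd h (?s h m) \<omega> *\<^sub>R G (v h) +
         (if h = g then W (Suc m) \<omega> *\<^sub>R G (v g) else 0))"
    using dur[OF g] sel g(1)
    by (intro sum.cong) (auto simp: duration_sum_def scaleR_add_left)
  also have "\<dots> = (\<Sum>h=0..d. duration_sum Wd h (?s h m) \<omega> *\<^sub>R G (v h)) + W (Suc m) \<omega> *\<^sub>R G (v g)"
    using g(1) by (simp add: sum.distrib)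
  finally show ?case
    using Suc.IH g(2) by simp
qed

lemma sum_selections:
  fixes v :: "nat \<Rightarrow> 'v"
  assumes "inj_on v {0..d}" "\<And>n. step_velocity W V n \<omega> \<in> v ` {0..d}"
  shows "(\<Sum>h=0..d. selections W V (v h) m \<omega>) = m"
proof -
  have "(\<Sum>h=0..d. selections W V (v h) m \<omega>) = card (\<Union>h\<in>{0..d}. {j. j < m \<and> step_velocity W V j \<omega> = v h})"
    unfolding selections_def
  proof (rule card_UN_disjoint[symmetric])
    show "\<forall>g\<in>{0..d}. \<forall>h\<in>{0..d}. g \<noteq> h \<longrightarrow>
        {j. j < m \<and> step_velocity W V j \<omega> = v g} \<inter> {j. j < m \<and> step_velocity W V j \<omega> = v h} = {}"
      using assms(1) by (auto simp: inj_on_def)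
  qed simp_all
  also have "(\<Union>h\<in>{0..d}. {j. j < m \<and> step_velocity W V j \<omega> = v h}) = {..<m}"
    using assms(2) by fastforce
  finally show ?thesis by simp
qed

text \<open>
  The almost sure properties of the motion that are used at the time \<open>t\<close>. For such a path the
  formulas for the position and for the numbers of displacements hold surely.
\<close>

definition (in minimal_random_motion) regular_path :: "real \<Rightarrow> 'a \<Rightarrow> bool" where
  "regular_path t \<omega> \<longleftrightarrow> \<omega> \<in> space M \<and> W 0 \<omega> = 0 \<and> (\<forall>n. 0 \<le> W n \<omega>) \<and> point_process W t \<omega> < \<infinity> \<and>
     (\<forall>s\<ge>0. V s \<omega> = step_velocity W V (the_enat (point_process W s \<omega>)) \<omega>) \<and>
     X t \<omega> = integral {0..t} (\<lambda>s. V s \<omega>) \<and>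
     (\<forall>n. \<forall>h\<le>CARD('d). step_velocity W V n \<omega> = v h \<longrightarrow>
          W (Suc n) \<omega> = Wd h (selections W V (v h) (Suc n) \<omega>) \<omega>)"

lemma (in minimal_random_motion) AE_regular_path:
  assumes "0 \<le> t"
  shows "AE \<omega> in M. regular_path t \<omega>"
proof -
  have "AE \<omega> in M. \<forall>n. 0 \<le> W n \<omega>"
    using W_nonneg by (simp add: AE_all_countable)
  with W_0 N_finite[OF assms] V_steps X_integral dur_steps AE_space show ?thesis
  proof eventually_elim
    case (elim \<omega>)
    then show ?case
      using assms unfolding regular_path_def by simp
  qed
qed

context minimal_random_motion
begin

context
  fixes t :: real and \<omega> :: 'a
  assumes reg: "regular_path t \<omega>" and t: "0 \<le> t"
begin

lemma arrival_time_0: "arrival_time W 0 \<omega> = 0"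
  using reg by (simp add: arrival_time_def regular_path_def)

lemma arrival_time_mono: "arrival_time W n \<omega> \<le> arrival_time W (Suc n) \<omega>"
  using reg by (simp add: arrival_time_Suc regular_path_def)

lemma arrival_time_nonneg: "0 \<le> arrival_time W n \<omega>"
  using reg by (auto simp: arrival_time_def regular_path_def intro: sum_nonneg)

lemma arrival_time_eq_sum: "arrival_time W n \<omega> = (\<Sum>j<n. W (Suc j) \<omega>)"
  by (induction n) (simp_all add: arrival_time_0 arrival_time_Suc)

lemma step_velocity_range: "step_velocity W V n \<omega> \<in> v ` {0..CARD('d)}"
  unfolding step_velocity_def
  using V_range[OF arrival_time_nonneg] reg by (simp add: regular_path_def)

lemma point_process_eq_iff:
  "point_process W t \<omega> = enat m \<longleftrightarrow> arrival_time W m \<omega> \<le> t \<and> t < arrival_time W (Suc m) \<omega>"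
  unfolding point_process_def
  using arrival_time_0 t by (intro count_until_eq_iff arrival_time_mono) simp

lemma displacements_eq_selections:
  assumes "point_process W t \<omega> = enat m"
  shows "displacements W V w t \<omega> = selections W V w (Suc m) \<omega>"
  unfolding displacements_def selections_def assms by (simp add: less_Suc_eq_le)

lemma position_eq:
  assumes "point_process W t \<omega> = enat m"
  shows "X t \<omega> = (\<Sum>j<m. W (Suc j) \<omega> *\<^sub>R step_velocity W V j \<omega>) +
    (t - arrival_time W m \<omega>) *\<^sub>R step_velocity W V m \<omega>"
proof -
  let ?c = "\<lambda>j. step_velocity W V j \<omega>" and ?T = "\<lambda>n. arrival_time W n \<omega>"
  have "((\<lambda>s. V s \<omega>) has_integral (\<Sum>j<m. (?T (Suc j) - ?T j) *\<^sub>R ?c j) + (t - ?T m) *\<^sub>R ?c m) {0..t}"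
  proof (rule has_integral_piecewise_constant)
    show "V s \<omega> = ?c (the_enat (count_until ?T s))" if "0 \<le> s" for s
      using reg that by (auto simp: regular_path_def point_process_def)
    show "?T m \<le> t" "t < ?T (Suc m)"
      using assms point_process_eq_iff[of m] by auto
  qed (simp_all add: arrival_time_mono arrival_time_0)
  then have "integral {0..t} (\<lambda>s. V s \<omega>) = (\<Sum>j<m. (?T (Suc j) - ?T j) *\<^sub>R ?c j) + (t - ?T m) *\<^sub>R ?c m"
    by (rule integral_unique)
  then show ?thesis
    using reg by (simp add: regular_path_def arrival_time_Suc)
qed

lemma sum_durations:
  fixes G :: "real ^ 'd::{finite,linorder} \<Rightarrow> 'b::real_vector"
  shows "(\<Sum>j<m. W (Suc j) \<omega> *\<^sub>R G (step_velocity W V j \<omega>)) =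
    (\<Sum>h=0..CARD('d). duration_sum Wd h (selections W V (v h) m \<omega>) \<omega> *\<^sub>R G (v h))"
proof (rule sum_durations_by_velocity[OF v_inj step_velocity_range])
  show "W (Suc n) \<omega> = Wd h (selections W V (v h) (Suc n) \<omega>) \<omega>"
    if "h \<le> CARD('d)" "step_velocity W V n \<omega> = v h" for n h
    using reg that by (simp add: regular_path_def)
qed

end

end

text \<open>
  The data of the event: the velocities \<open>v (i 0), \<dots>, v (i H)\<close> are selected \<open>n (i 0), \<dots>, n (i H)\<close> times,
  all others never, and the last selection is \<open>v (i k)\<close>.
\<close>

locale velocity_selection = minimal_random_motion M W V X v Wd
  for M :: "'a measure" and W :: "nat \<Rightarrow> 'a \<Rightarrow> real"
    and V X :: "real \<Rightarrow> 'a \<Rightarrow> real ^ 'd::{finite,linorder}"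
    and v :: "nat \<Rightarrow> real ^ 'd::{finite,linorder}" and Wd :: "nat \<Rightarrow> nat \<Rightarrow> 'a \<Rightarrow> real" +
  fixes H k :: nat and i n :: "nat \<Rightarrow> nat"
  assumes i_inj: "inj_on i {0..H}" and i_range: "i ` {0..H} \<subseteq> {0..CARD('d)}" and k: "k \<le> H"
    and n_pos: "\<And>h. h \<le> H \<Longrightarrow> 1 \<le> n (i h)"
    and n_zero: "\<And>j. j \<in> {0..CARD('d)} - i ` {0..H} \<Longrightarrow> n j = 0"
begin

definition "total_steps = (\<Sum>h=0..H. n (i h))"

text \<open>
  The part of the event that concerns the order of the velocities only.
\<close>

definition allocation :: "'a \<Rightarrow> bool" where
  "allocation \<omega> \<longleftrightarrow> (\<forall>h\<le>CARD('d). selections W V (v h) total_steps \<omega> = n h) \<and>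
     step_velocity W V (total_steps - 1) \<omega> = v (i k)"

lemma i_le: "h \<le> H \<Longrightarrow> i h \<le> CARD('d)"
  using i_range by (simp add: image_subset_iff)

lemma sum_over_selected:
  assumes "\<And>j. j \<in> {0..CARD('d)} - i ` {0..H} \<Longrightarrow> g j = 0"
  shows "(\<Sum>j=0..CARD('d). g j) = (\<Sum>h=0..H. g (i h) :: 'b::comm_monoid_add)"
proof -
  have "(\<Sum>j=0..CARD('d). g j) = (\<Sum>j\<in>i ` {0..H}. g j)"
    using i_range assms by (intro sum.mono_neutral_right) auto
  also have "\<dots> = (\<Sum>h=0..H. g (i h))"
    using i_inj by (simp add: sum.reindex)
  finally show ?thesis .
qed

lemma total_steps_pos: "0 < total_steps"
proof -
  have "n (i k) \<le> total_steps"
    unfolding total_steps_def using k by (intro member_le_sum) auto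
  then show ?thesis
    using n_pos[OF k] by simp
qed

text \<open>
  Every step has exactly one velocity, so the numbers of displacements add up to the number of steps begun.
  This turns the prescribed numbers into a condition on the number of events by time \<open>t\<close>.
\<close>

lemma event_iff_allocation:
  assumes reg: "regular_path t \<omega>" and t: "0 \<le> t"
  shows "(\<forall>h\<le>H. displacements W V (v (i h)) t \<omega> = n (i h)) \<and>
      (\<forall>j\<in>{0..CARD('d)} - i ` {0..H}. displacements W V (v j) t \<omega> = 0) \<and> V t \<omega> = v (i k) \<longleftrightarrow>
    allocation \<omega> \<and> point_process W t \<omega> = enat (total_steps - 1)"
    (is "?E \<longleftrightarrow> _")
proof -
  obtain m where m: "point_process W t \<omega> = enat m"
    using reg by (auto simp: regular_path_def)
  have V: "V t \<omega> = step_velocity W V m \<omega>"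
    using reg t m by (auto simp: regular_path_def)
  have disp: "displacements W V w t \<omega> = selections W V w (Suc m) \<omega>" for w
    by (rule displacements_eq_selections[OF reg t m])
  have sum: "(\<Sum>h=0..CARD('d). selections W V (v h) (Suc m) \<omega>) = Suc m"
    using v_inj step_velocity_range[OF reg t] by (rule sum_selections)
  have E: "?E \<longleftrightarrow> (\<forall>h\<le>CARD('d). selections W V (v h) (Suc m) \<omega> = n h) \<and> step_velocity W V m \<omega> = v (i k)"
  proof -
    have "(\<forall>h\<le>CARD('d). P h) \<longleftrightarrow> (\<forall>h\<le>H. P (i h)) \<and> (\<forall>j\<in>{0..CARD('d)} - i ` {0..H}. P j)" for P
      using i_le by (auto simp: image_iff)
    then show ?thesis
      using n_zero unfolding disp V by simp
  qed
  show ?thesis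
  proof
    assume ?E
    then have sel: "\<forall>h\<le>CARD('d). selections W V (v h) (Suc m) \<omega> = n h" and vm: "step_velocity W V m \<omega> = v (i k)"
      using E by auto
    have "Suc m = (\<Sum>h=0..CARD('d). n h)"
      using sum sel by simp
    also have "\<dots> = total_steps"
      unfolding total_steps_def by (rule sum_over_selected[OF n_zero])
    finally have "total_steps = Suc m" by simp
    then show "allocation \<omega> \<and> point_process W t \<omega> = enat (total_steps - 1)"
      using sel vm m by (simp add: allocation_def)
  next
    assume a: "allocation \<omega> \<and> point_process W t \<omega> = enat (total_steps - 1)"
    then have "total_steps = Suc m"
      using m total_steps_pos by auto
    then show ?E
      using a unfolding E by (simp add: allocation_def)
  qed
qed

text \<open>
  The last selected step has velocity \<open>v (i k)\<close>, so leaving it out lowers only this count.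
\<close>

lemma selections_before_last:
  assumes "allocation \<omega>" "h \<le> CARD('d)"
  shows "selections W V (v h) (total_steps - 1) \<omega> = (if h = i k then n h - 1 else n h)"
proof -
  let ?m = "total_steps - 1"
  have ts: "total_steps = Suc ?m"
    using total_steps_pos by simp
  have last: "step_velocity W V ?m \<omega> = v (i k)"
    using assms(1) by (simp add: allocation_def)
  have "v (i k) = v h \<longleftrightarrow> h = i k"
    using v_inj assms(2) i_le[OF k] by (auto dest: inj_onD)
  moreover have "{j. j < Suc ?m \<and> step_velocity W V j \<omega> = v h} =
      (if step_velocity W V ?m \<omega> = v h then insert ?m else id) {j. j < ?m \<and> step_velocity W V j \<omega> = v h}"
    by (auto simp: less_Suc_eq)
  ultimately have "selections W V (v h) (Suc ?m) \<omega> =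
      (if h = i k then Suc (selections W V (v h) ?m \<omega>) else selections W V (v h) ?m \<omega>)"
    unfolding selections_def last by auto
  moreover have "selections W V (v h) (Suc ?m) \<omega> = n h"
    using assms unfolding ts[symmetric] by (simp add: allocation_def)
  ultimately show ?thesis by auto
qed

lemma sum_durations_allocation:
  fixes G :: "real ^ 'd::{finite,linorder} \<Rightarrow> 'b::real_vector"
  assumes reg: "regular_path t \<omega>" and t: "0 \<le> t" and a: "allocation \<omega>"
  shows "(\<Sum>j<total_steps - 1. W (Suc j) \<omega> *\<^sub>R G (step_velocity W V j \<omega>)) =
      (\<Sum>h\<in>{0..H} - {k}. duration_sum Wd (i h) (n (i h)) \<omega> *\<^sub>R G (v (i h))) +
      duration_sum Wd (i k) (n (i k) - 1) \<omega> *\<^sub>R G (v (i k))"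
    (is "?L = _")
proof -
  let ?n' = "\<lambda>h. if h = i k then n h - 1 else n h"
  have "?L = (\<Sum>h=0..CARD('d). duration_sum Wd h (?n' h) \<omega> *\<^sub>R G (v h))"
    unfolding sum_durations[OF reg t, of G]
    by (rule sum.cong) (simp_all only: selections_before_last[OF a] atLeastAtMost_iff)
  also have "\<dots> = (\<Sum>h=0..H. duration_sum Wd (i h) (?n' (i h)) \<omega> *\<^sub>R G (v (i h)))"
    using n_zero by (intro sum_over_selected) (auto simp: duration_sum_def)
  also have "\<dots> = (\<Sum>h\<in>{0..H} - {k}. duration_sum Wd (i h) (?n' (i h)) \<omega> *\<^sub>R G (v (i h))) +
      duration_sum Wd (i k) (?n' (i k)) \<omega> *\<^sub>R G (v (i k))"
    using k by (subst sum.remove[of _ k]) (simp_all add: add.commute)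
  also have "(\<Sum>h\<in>{0..H} - {k}. duration_sum Wd (i h) (?n' (i h)) \<omega> *\<^sub>R G (v (i h))) =
      (\<Sum>h\<in>{0..H} - {k}. duration_sum Wd (i h) (n (i h)) \<omega> *\<^sub>R G (v (i h)))"
    using i_inj k by (intro sum.cong) (auto dest: inj_onD)
  finally show ?thesis by simp
qed

text \<open>
  Given the allocation, the path up to time \<open>t\<close> depends on the order of the velocities no more: the time
  \<open>t - s\<close> that is not spent with the other velocities is spent with \<open>v (i k)\<close>.
\<close>

lemma allocation_path:
  assumes reg: "regular_path t \<omega>" and t: "0 \<le> t" and a: "allocation \<omega>"
  defines "s \<equiv> \<Sum>h\<in>{0..H} - {k}. duration_sum Wd (i h) (n (i h)) \<omega>"
  shows "point_process W t \<omega> = enat (total_steps - 1) \<longleftrightarrow>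
      duration_sum Wd (i k) (n (i k) - 1) \<omega> \<le> t - s \<and> t - s < duration_sum Wd (i k) (n (i k)) \<omega>"
    and "point_process W t \<omega> = enat (total_steps - 1) \<Longrightarrow>
      X t \<omega> = t *\<^sub>R v (i k) +
        (\<Sum>h\<in>{0..H} - {k}. duration_sum Wd (i h) (n (i h)) \<omega> *\<^sub>R (v (i h) - v (i k)))"
proof -
  let ?m = "total_steps - 1"
  have last: "step_velocity W V ?m \<omega> = v (i k)" and sel: "selections W V (v (i k)) (Suc ?m) \<omega> = n (i k)"
    using a total_steps_pos i_le[OF k] by (auto simp: allocation_def)
  have T: "arrival_time W ?m \<omega> = s + duration_sum Wd (i k) (n (i k) - 1) \<omega>"
    using sum_durations_allocation[OF reg t a, of "\<lambda>_. 1 :: real"]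
    by (simp add: arrival_time_eq_sum[OF reg t] s_def)
  have "W (Suc ?m) \<omega> = Wd (i k) (n (i k)) \<omega>"
    using reg last i_le[OF k] sel unfolding regular_path_def by metis
  moreover have "duration_sum Wd (i k) (n (i k)) \<omega> =
      duration_sum Wd (i k) (n (i k) - 1) \<omega> + Wd (i k) (n (i k)) \<omega>"
    using n_pos[OF k] by (cases "n (i k)") (simp_all add: duration_sum_def)
  ultimately have T': "arrival_time W (Suc ?m) \<omega> = s + duration_sum Wd (i k) (n (i k)) \<omega>"
    by (simp only: arrival_time_Suc T add.assoc)
  show "point_process W t \<omega> = enat ?m \<longleftrightarrow>
      duration_sum Wd (i k) (n (i k) - 1) \<omega> \<le> t - s \<and> t - s < duration_sum Wd (i k) (n (i k)) \<omega>"
    unfolding point_process_eq_iff[OF reg t] T T' by auto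
  assume m: "point_process W t \<omega> = enat ?m"
  show "X t \<omega> = t *\<^sub>R v (i k) +
        (\<Sum>h\<in>{0..H} - {k}. duration_sum Wd (i h) (n (i h)) \<omega> *\<^sub>R (v (i h) - v (i k)))"
    unfolding position_eq[OF reg t m] last T sum_durations_allocation[OF reg t a, of "\<lambda>x. x"]
    by (simp add: s_def algebra_simps sum.distrib sum_subtractf scaleR_left.sum)
qed

end

section \<open>Measurability of the durations and of the allocation\<close>

context minimal_random_motion
begin

text \<open>
  The two independent sigma-algebras. Both are contained in the events, and this also is where the
  measurability of the step velocities and of the durations comes from.
\<close>

definition "duration_algebra = vimage_algebra (space M)
  (\<lambda>\<omega>. \<lambda>(h, m)\<in>{0..CARD('d)} \<times> {1..}. Wd h m \<omega>) (PiM ({0..CARD('d)} \<times> {1..}) (\<lambda>_. borel))"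

definition "allocation_algebra =
  vimage_algebra (space M) (\<lambda>\<omega> n. step_velocity W V n \<omega>) (PiM UNIV (\<lambda>_. borel))"

lemma space_algebras [simp]:
  "space duration_algebra = space M" "space allocation_algebra = space M"
  by (simp_all add: duration_algebra_def allocation_algebra_def)

lemma indep_algebras: "indep_set (sets duration_algebra) (sets allocation_algebra)"
  using dur_indep_alloc unfolding duration_algebra_def allocation_algebra_def .

lemma sets_algebras:
  "sets duration_algebra \<subseteq> events" "sets allocation_algebra \<subseteq> events"
  using indep_setD_ev1[OF indep_algebras] indep_setD_ev2[OF indep_algebras] by auto

lemma Wd_measurable_duration_algebra:
  assumes "h \<le> CARD('d)" "1 \<le> m"
  shows "Wd h m \<in> borel_measurable duration_algebra"
proof -
  let ?f = "\<lambda>\<omega>. \<lambda>(h, m)\<in>{0..CARD('d)} \<times> {1..}. Wd h m \<omega>"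
  have "?f \<in> duration_algebra \<rightarrow>\<^sub>M PiM ({0..CARD('d)} \<times> {1..}) (\<lambda>_. borel)"
    unfolding duration_algebra_def by (rule measurable_vimage_algebra1) (auto simp: space_PiM)
  then have "(\<lambda>\<omega>. ?f \<omega> (h, m)) \<in> borel_measurable duration_algebra"
    by (rule measurable_compose) (use assms in \<open>auto intro!: measurable_component_singleton\<close>)
  then show ?thesis
    using assms by simp
qed

lemma duration_sum_measurable_duration_algebra:
  "h \<le> CARD('d) \<Longrightarrow> duration_sum Wd h n \<in> borel_measurable duration_algebra"
  unfolding duration_sum_def[abs_def]
  by (rule borel_measurable_sum) (simp add: Wd_measurable_duration_algebra)

lemma duration_sum_measurable:
  "h \<le> CARD('d) \<Longrightarrow> duration_sum Wd h n \<in> borel_measurable M"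
  by (rule measurable_of_subalgebra[OF duration_sum_measurable_duration_algebra])
     (simp_all add: sets_algebras)

lemma step_velocity_measurable_allocation_algebra:
  "step_velocity W V n \<in> borel_measurable allocation_algebra"
proof -
  have "(\<lambda>\<omega> n. step_velocity W V n \<omega>) \<in> allocation_algebra \<rightarrow>\<^sub>M PiM UNIV (\<lambda>_. borel)"
    unfolding allocation_algebra_def by (rule measurable_vimage_algebra1) (auto simp: space_PiM)
  from measurable_compose[OF this measurable_component_singleton[of n]]
  show ?thesis by simp
qed

lemma step_velocity_measurable: "step_velocity W V n \<in> borel_measurable M"
  by (rule measurable_of_subalgebra[OF step_velocity_measurable_allocation_algebra])
     (simp_all add: sets_algebras)

lemma selections_measurable:
  assumes [measurable]: "\<And>n. step_velocity W V n \<in> borel_measurable N"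
  shows "selections W V w n \<in> N \<rightarrow>\<^sub>M count_space UNIV"
  unfolding selections_def[abs_def] by measurable

lemma displacements_measurable:
  "displacements W V w t \<in> M \<rightarrow>\<^sub>M count_space UNIV"
proof -
  note [measurable] = W_measurable step_velocity_measurable
  have "point_process W t \<in> M \<rightarrow>\<^sub>M count_space UNIV"
    unfolding point_process_def[abs_def] arrival_time_def
    by (rule measurable_count_until) measurable
  note [measurable] = this
  show ?thesis
    unfolding displacements_def[abs_def] by measurable
qed

end

section \<open>The density on a face of the simplex\<close>

context velocity_selection
begin

abbreviation "u \<equiv> \<lambda>h. v (i h)"
abbreviation "p \<equiv> hull_projection u H"
abbreviation "w \<equiv> \<lambda>h. p (u h)"
abbreviation "e \<equiv> \<lambda>b. i (insert_index k b)"
abbreviation "D \<equiv> difference_matrix w H k"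

text \<open>
  The two groups of durations that are independent of each other: the total durations with the velocities
  other than \<open>v (i k)\<close>, and the partial sums of order \<open>n (i k) - 1\<close> and \<open>n (i k)\<close> of the durations
  with \<open>v (i k)\<close>. Both take values in functions on \<open>nat\<close>, because \<open>indep_var\<close> relates variables of one type.
\<close>

definition "other_durations \<omega> = (\<lambda>b\<in>{..<H}. duration_sum Wd (e b) (n (e b)) \<omega>)"

definition "last_durations \<omega> = (\<lambda>c\<in>{..<2::nat}. duration_sum Wd (i k) (n (i k) - 1 + c) \<omega>)"

text \<open>
  The projected position at time \<open>t\<close> as a function of the total durations of the other velocities.
\<close>

definition "position_of t z = (\<lambda>a\<in>{..<H}. t * w k a + (\<Sum>b<H. D $$ (a, b) * z b))"

definition "last_velocity_event t z \<omega> \<longleftrightarrow>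
  duration_sum Wd (i k) (n (i k) - 1) \<omega> \<le> t - (\<Sum>b<H. z b) \<and>
  t - (\<Sum>b<H. z b) < duration_sum Wd (i k) (n (i k)) \<omega>"

lemmas u_affine_independent = selected_velocities_affine_independent[OF i_inj i_range]

lemma w_affine_independent: "affinely_independent_family H {0..H} w"
  by (rule affinely_independent_hull_projection[OF u_affine_independent])

lemma p_apply: "p x = (\<lambda>a\<in>{..<H}. x $ (sorted_list_of_set (first_independent_rows u H 0) ! a))"
  unfolding hull_projection_def coordinate_projection_def
  by (simp add: card_first_independent_rows[OF u_affine_independent])

lemma bij_e: "bij_betw (insert_index k) {..<H} ({0..H} - {k})"
  by (rule bij_betw_insert_index[OF k])

lemma insert_index_le: "b < H \<Longrightarrow> insert_index k b \<le> H"
  by (simp add: insert_index_def)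

lemma e_le: "b < H \<Longrightarrow> e b \<le> CARD('d)"
  by (rule i_le) (rule insert_index_le)

lemma e_inj: "inj_on e {..<H}"
proof (rule inj_onI)
  fix a b assume "a \<in> {..<H}" "b \<in> {..<H}" "e a = e b"
  then have "insert_index k a = insert_index k b"
    using i_inj insert_index_le by (auto dest: inj_onD)
  then show "a = b"
    by (metis delete_insert_index)
qed

lemma e_neq: "b < H \<Longrightarrow> e b \<noteq> i k"
  using i_inj insert_index_le[of b] k insert_index_exclude[of k b] by (auto dest: inj_onD)

lemma projected_position:
  assumes "regular_path t \<omega>" "0 \<le> t" "allocation \<omega>"
    and "point_process W t \<omega> = enat (total_steps - 1)"
  shows "p (X t \<omega>) = position_of t (other_durations \<omega>)"
proof
  fix a
  show "p (X t \<omega>) a = position_of t (other_durations \<omega>) a"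
  proof (cases "a < H")
    case True
    define r where "r = sorted_list_of_set (first_independent_rows u H 0) ! a"
    have w: "w h a = u h $ r" for h
      using True by (simp add: p_apply r_def)
    have "p (X t \<omega>) a = X t \<omega> $ r"
      using True by (simp add: p_apply r_def)
    also have "\<dots> = t * w k a + (\<Sum>h\<in>{0..H} - {k}. duration_sum Wd (i h) (n (i h)) \<omega> * (w h a - w k a))"
      unfolding allocation_path(2)[OF assms] w by (simp add: sum_component)
    also have "(\<Sum>h\<in>{0..H} - {k}. duration_sum Wd (i h) (n (i h)) \<omega> * (w h a - w k a)) =
        (\<Sum>b<H. duration_sum Wd (e b) (n (e b)) \<omega> * (w (insert_index k b) a - w k a))"
      by (rule sum.reindex_bij_betw[OF bij_e, symmetric])
    also have "\<dots> = (\<Sum>b<H. D $$ (a, b) * other_durations \<omega> b)"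
      using True by (intro sum.cong) (simp_all add: difference_matrix_def other_durations_def mult.commute)
    finally show ?thesis
      using True by (simp add: position_of_def)
  qed (simp add: p_apply position_of_def)
qed

lemma event_iff:
  assumes reg: "regular_path t \<omega>" and t: "0 \<le> t"
  shows "p (X t \<omega>) \<in> B \<and>
      (\<forall>h\<le>H. displacements W V (v (i h)) t \<omega> = n (i h)) \<and>
      (\<forall>j\<in>{0..CARD('d)} - i ` {0..H}. displacements W V (v j) t \<omega> = 0) \<and> V t \<omega> = v (i k) \<longleftrightarrow>
    allocation \<omega> \<and> position_of t (other_durations \<omega>) \<in> B \<and>
      last_velocity_event t (other_durations \<omega>) \<omega>"
proof (cases "allocation \<omega>")
  case True
  have "(\<Sum>h\<in>{0..H} - {k}. duration_sum Wd (i h) (n (i h)) \<omega>) = (\<Sum>b<H. other_durations \<omega> b)"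
    unfolding other_durations_def by (subst sum.reindex_bij_betw[OF bij_e, symmetric]) simp
  then have "point_process W t \<omega> = enat (total_steps - 1) \<longleftrightarrow> last_velocity_event t (other_durations \<omega>) \<omega>"
    unfolding allocation_path(1)[OF reg t True] last_velocity_event_def by simp
  then show ?thesis
    using event_iff_allocation[OF reg t] projected_position[OF reg t True] True by auto
qed (use event_iff_allocation[OF reg t] in auto)

text \<open>
  The durations are nonnegative, so the partial sums increase and the count is determined by two of them.
\<close>

lemma count_last_velocity:
  assumes "(\<Sum>b<H. z b) \<le> t"
  shows "AE \<omega> in M. last_velocity_event t z \<omega> \<longleftrightarrow>
    count_until (\<lambda>m. duration_sum Wd (i k) m \<omega>) (t - (\<Sum>b<H. z b)) = enat (n (i k) - 1)"
proof -
  have "AE \<omega> in M. \<forall>m. 0 \<le> Wd (i k) (Suc m) \<omega>"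
    using dur_nonneg[OF i_le[OF k]] by (simp add: AE_all_countable)
  then show ?thesis
  proof eventually_elim
    case (elim \<omega>)
    have "count_until (\<lambda>m. duration_sum Wd (i k) m \<omega>) (t - (\<Sum>b<H. z b)) = enat (n (i k) - 1) \<longleftrightarrow>
      duration_sum Wd (i k) (n (i k) - 1) \<omega> \<le> t - (\<Sum>b<H. z b) \<and>
      t - (\<Sum>b<H. z b) < duration_sum Wd (i k) (Suc (n (i k) - 1)) \<omega>"
      using elim assms by (intro count_until_eq_iff) (auto simp: duration_sum_def)
    then show ?case
      using n_pos[OF k] by (simp add: last_velocity_event_def)
  qed
qed

lemma position_of_measurable:
  "position_of t \<in> (\<Pi>\<^sub>M b\<in>{..<H}. lborel) \<rightarrow>\<^sub>M (\<Pi>\<^sub>M a\<in>{..<H}. lborel)"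
  unfolding position_of_def[abs_def] by (rule measurable_restrict) simp

lemma g_inverse_position_of:
  "b < H \<Longrightarrow> g_inverse w H k t (position_of t z) (insert_index k b) = z b"
  by (rule g_inverse_affine[OF w_affine_independent k]) (simp_all add: position_of_def)

lemma indep_durations:
  "indep_var (\<Pi>\<^sub>M b\<in>{..<H}. lborel) other_durations (\<Pi>\<^sub>M c\<in>{..<2}. lborel) last_durations"
proof -
  let ?N = "\<lambda>_::nat. PiM {1::nat..} (\<lambda>_. borel :: real measure)"
  let ?X = "\<lambda>h \<omega>. \<lambda>m\<in>{1..}. Wd h m \<omega>"
  let ?f = "\<lambda>\<xi>. \<lambda>b\<in>{..<H}. \<Sum>j=1..n (e b). \<xi> (e b) j"
  let ?g = "\<lambda>\<xi>. \<lambda>c\<in>{..<2}. \<Sum>j=1..n (i k) - 1 + c. \<xi> (i k) j"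
  have f: "?f \<in> PiM (e ` {..<H}) ?N \<rightarrow>\<^sub>M (\<Pi>\<^sub>M b\<in>{..<H}. lborel)"
    by (rule measurable_restrict, rule measurable_partial_sum_component) simp
  have g: "?g \<in> PiM {i k} ?N \<rightarrow>\<^sub>M (\<Pi>\<^sub>M c\<in>{..<2}. lborel)"
    by (rule measurable_restrict, rule measurable_partial_sum_component) simp
  have "i k \<notin> e ` {..<H}"
    using e_neq by (metis imageE lessThan_iff)
  then have "indep_var (PiM (e ` {..<H}) ?N) (\<lambda>\<omega>. restrict (\<lambda>h. ?X h \<omega>) (e ` {..<H}))
      (PiM {i k} ?N) (\<lambda>\<omega>. restrict (\<lambda>h. ?X h \<omega>) {i k})"
    by (intro indep_var_restrict[OF dur_indep]) (use e_le i_le[OF k] in \<open>simp_all add: image_subset_iff\<close>)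
  from indep_var_compose[OF this f g]
  have "indep_var (\<Pi>\<^sub>M b\<in>{..<H}. lborel) (?f \<circ> (\<lambda>\<omega>. restrict (\<lambda>h. ?X h \<omega>) (e ` {..<H})))
    (\<Pi>\<^sub>M c\<in>{..<2}. lborel) (?g \<circ> (\<lambda>\<omega>. restrict (\<lambda>h. ?X h \<omega>) {i k}))" .
  moreover have "?f \<circ> (\<lambda>\<omega>. restrict (\<lambda>h. ?X h \<omega>) (e ` {..<H})) = other_durations"
    by (rule ext) (auto simp: other_durations_def duration_sum_def intro!: restrict_ext sum.cong)
  moreover have "?g \<circ> (\<lambda>\<omega>. restrict (\<lambda>h. ?X h \<omega>) {i k}) = last_durations"
    by (rule ext) (auto simp: last_durations_def duration_sum_def intro!: restrict_ext sum.cong)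
  ultimately show ?thesis by (simp only:)
qed

lemma distr_other_durations:
  assumes dens: "\<And>h m. h \<le> CARD('d) \<Longrightarrow> 1 \<le> m \<Longrightarrow> distributed M lborel (duration_sum Wd h m) (f h m)"
  shows "distr M (\<Pi>\<^sub>M b\<in>{..<H}. lborel) other_durations =
    density (\<Pi>\<^sub>M b\<in>{..<H}. lborel) (\<lambda>z. \<Prod>b<H. f (e b) (n (e b)) (z b))"
  unfolding other_durations_def[abs_def]
proof (rule distr_indep_density)
  let ?N = "\<lambda>_::nat. PiM {1::nat..} (\<lambda>_. borel :: real measure)"
  let ?X = "\<lambda>h \<omega>. \<lambda>m\<in>{1..}. Wd h m \<omega>"
  have "disjoint_family_on (\<lambda>b. {e b}) {..<H}"
    using e_inj by (auto simp: disjoint_family_on_def inj_on_def)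
  then have "indep_vars (\<lambda>b. PiM {e b} ?N) (\<lambda>b \<omega>. restrict (\<lambda>h. ?X h \<omega>) {e b}) {..<H}"
    by (intro indep_vars_restrict[OF dur_indep]) (use e_le in auto)
  then have "indep_vars (\<lambda>_. lborel) (\<lambda>b \<omega>. (\<lambda>\<xi>. \<Sum>j=1..n (e b). \<xi> (e b) j) (restrict (\<lambda>h. ?X h \<omega>) {e b})) {..<H}"
  proof (rule indep_vars_compose2)
    fix b
    show "(\<lambda>\<xi>. \<Sum>j=1..n (e b). \<xi> (e b) j) \<in> PiM {e b} ?N \<rightarrow>\<^sub>M lborel"
      by (rule measurable_partial_sum_component) simp
  qed
  moreover have "(\<lambda>b \<omega>. (\<lambda>\<xi>. \<Sum>j=1..n (e b). \<xi> (e b) j) (restrict (\<lambda>h. ?X h \<omega>) {e b})) =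
      (\<lambda>b. duration_sum Wd (e b) (n (e b)))"
    by (intro ext) (auto simp: duration_sum_def intro!: sum.cong)
  ultimately show "indep_vars (\<lambda>_. lborel) (\<lambda>b. duration_sum Wd (e b) (n (e b))) {..<H}"
    by (simp only:)
  show "distributed M lborel (duration_sum Wd (e b) (n (e b))) (f (e b) (n (e b)))" if "b < H" for b
    using dens e_le[OF that] n_pos[OF insert_index_le[OF that]] by simp
qed

lemma p_measurable: "p \<in> borel \<rightarrow>\<^sub>M (\<Pi>\<^sub>M a\<in>{..<H}. lborel)"
proof -
  let ?r = "\<lambda>a. sorted_list_of_set (first_independent_rows u H 0) ! a"
  have "(\<lambda>x. x $ ?r a) \<in> borel \<rightarrow>\<^sub>M (lborel :: real measure)" for a
    using borel_measurable_continuous_onI[of "\<lambda>x. x $ ?r a"]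
    by (simp add: continuous_on_component continuous_on_id)
  then have "(\<lambda>x. \<lambda>a\<in>{..<H}. x $ ?r a) \<in> borel \<rightarrow>\<^sub>M (\<Pi>\<^sub>M a\<in>{..<H}. lborel :: real measure)"
    by (rule measurable_restrict)
  then show ?thesis
    by (simp only: p_apply[abs_def])
qed

lemma allocation_event: "{\<omega> \<in> space M. allocation \<omega>} \<in> sets allocation_algebra"
proof -
  let ?A = allocation_algebra
  have "{\<omega> \<in> space ?A. selections W V (v h) total_steps \<omega> = n h} \<in> sets ?A" for h
    using measurable_sets[OF selections_measurable[OF step_velocity_measurable_allocation_algebra],
        of "{n h}" "v h" total_steps]
    by (simp add: vimage_def Int_def conj_commute)
  then have "{\<omega> \<in> space ?A. \<forall>h\<in>{..CARD('d)}. selections W V (v h) total_steps \<omega> = n h} \<in> sets ?A"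
    by (intro sets.sets_Collect_finite_All) auto
  moreover have "{\<omega> \<in> space ?A. step_velocity W V (total_steps - 1) \<omega> = v (i k)} \<in> sets ?A"
    using measurable_sets[OF step_velocity_measurable_allocation_algebra,
        of "{v (i k)}" "total_steps - 1"]
    by (simp add: vimage_def Int_def conj_commute)
  ultimately have "{\<omega> \<in> space ?A. (\<forall>h\<in>{..CARD('d)}. selections W V (v h) total_steps \<omega> = n h) \<and>
      step_velocity W V (total_steps - 1) \<omega> = v (i k)} \<in> sets ?A"
    by (rule sets.sets_Collect_conj[rotated])
  moreover have "allocation \<omega> \<longleftrightarrow> (\<forall>h\<in>{..CARD('d)}. selections W V (v h) total_steps \<omega> = n h) \<and>
      step_velocity W V (total_steps - 1) \<omega> = v (i k)" for \<omega>
    unfolding allocation_def by auto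
  ultimately show ?thesis
    by (simp only: space_algebras)
qed

lemma durations_measurable:
  "(\<lambda>\<omega>. (other_durations \<omega>, last_durations \<omega>)) \<in>
     duration_algebra \<rightarrow>\<^sub>M (\<Pi>\<^sub>M b\<in>{..<H}. lborel) \<Otimes>\<^sub>M (\<Pi>\<^sub>M c\<in>{..<2}. lborel)"
proof (rule measurable_Pair)
  show "other_durations \<in> duration_algebra \<rightarrow>\<^sub>M (\<Pi>\<^sub>M b\<in>{..<H}. lborel)"
    unfolding other_durations_def[abs_def]
    by (rule measurable_restrict) (simp add: duration_sum_measurable_duration_algebra e_le)
  show "last_durations \<in> duration_algebra \<rightarrow>\<^sub>M (\<Pi>\<^sub>M c\<in>{..<2}. lborel)"
    unfolding last_durations_def[abs_def]
    by (rule measurable_restrict) (simp add: duration_sum_measurable_duration_algebra i_le[OF k])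
qed

definition "count_probability r = emeasure M {\<omega> \<in> space M.
  count_until (\<lambda>m. duration_sum Wd (i k) m \<omega>) r = enat (n (i k) - 1)}"

definition "time_spent t y b = g_inverse w H k t y (insert_index k b)"

lemma time_spent_position_of: "b < H \<Longrightarrow> time_spent t (position_of t z) b = z b"
  unfolding time_spent_def by (rule g_inverse_position_of)

lemma time_spent_measurable:
  "b < H \<Longrightarrow> (\<lambda>y. time_spent t y b) \<in> borel_measurable (\<Pi>\<^sub>M a\<in>{..<H}. lborel)"
  unfolding time_spent_def by (rule g_inverse_measurable[OF w_affine_independent k])

text \<open>
  The density without the factors that do not depend on the position.
\<close>

definition "density_term f t B y = (\<Prod>b<H. f (e b) (n (e b)) (time_spent t y b)) *
  count_probability (t - (\<Sum>b<H. time_spent t y b)) * indicator B y"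

context
  fixes f :: "nat \<Rightarrow> nat \<Rightarrow> real \<Rightarrow> ennreal" and t :: real and B :: "(nat \<Rightarrow> real) set"
  assumes dens: "\<And>h m. h \<le> CARD('d) \<Longrightarrow> 1 \<le> m \<Longrightarrow> distributed M lborel (duration_sum Wd h m) (f h m)"
    and t: "0 \<le> t" and B: "B \<in> sets (\<Pi>\<^sub>M a\<in>{..<H}. lborel)"
    and B_hull: "B \<subseteq> p ` (convex hull ((\<lambda>h. t *\<^sub>R u h) ` {0..H}))"
begin

lemma density_term_measurable: "density_term f t B \<in> borel_measurable (\<Pi>\<^sub>M a\<in>{..<H}. lborel)"
proof -
  have "(\<lambda>y. f (e b) (n (e b)) (time_spent t y b)) \<in> borel_measurable (\<Pi>\<^sub>M a\<in>{..<H}. lborel)" if "b < H" for b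
  proof -
    have "f (e b) (n (e b)) \<in> borel_measurable borel"
      using dens[OF e_le[OF that] n_pos[OF insert_index_le[OF that]]] by (simp add: distributed_def)
    with time_spent_measurable[OF that] show ?thesis
      by (rule measurable_compose)
  qed
  then have 1: "(\<lambda>y. \<Prod>b<H. f (e b) (n (e b)) (time_spent t y b)) \<in> borel_measurable (\<Pi>\<^sub>M a\<in>{..<H}. lborel)"
    by (intro borel_measurable_prod_ennreal) simp
  have "(\<lambda>y. t - (\<Sum>b<H. time_spent t y b)) \<in> borel_measurable (\<Pi>\<^sub>M a\<in>{..<H}. lborel)"
    by (intro borel_measurable_diff borel_measurable_const borel_measurable_sum time_spent_measurable) simp
  moreover have "count_probability \<in> borel_measurable borel"
    unfolding count_probability_def[abs_def]
    by (rule measurable_prob_count_until) (rule duration_sum_measurable[OF i_le[OF k]])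
  ultimately have 2: "(\<lambda>y. count_probability (t - (\<Sum>b<H. time_spent t y b))) \<in>
      borel_measurable (\<Pi>\<^sub>M a\<in>{..<H}. lborel)"
    by (rule measurable_compose)
  show ?thesis
    unfolding density_term_def[abs_def] using 1 2 B by measurable
qed

text \<open>
  Conditionally on the total durations \<open>z\<close> with the other velocities, the last velocity contributes the
  probability of its count. The integral over \<open>z\<close> is then transported to the position. As \<open>B\<close> lies in
  the hull, the remaining time is nonnegative wherever the position is in \<open>B\<close>.
\<close>

lemma emeasure_durations_event:
  defines "Q \<equiv> {x \<in> space ((\<Pi>\<^sub>M b\<in>{..<H}. lborel) \<Otimes>\<^sub>M (\<Pi>\<^sub>M c\<in>{..<2::nat}. lborel)).
      position_of t (fst x) \<in> B \<and> snd x 0 \<le> t - (\<Sum>b<H. fst x b) \<and> t - (\<Sum>b<H. fst x b) < snd x 1}"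
  shows "Q \<in> sets ((\<Pi>\<^sub>M b\<in>{..<H}. lborel) \<Otimes>\<^sub>M (\<Pi>\<^sub>M c\<in>{..<2}. lborel))"
    and "\<omega> \<in> space M \<Longrightarrow> (other_durations \<omega>, last_durations \<omega>) \<in> Q \<longleftrightarrow>
      position_of t (other_durations \<omega>) \<in> B \<and> last_velocity_event t (other_durations \<omega>) \<omega>"
    and "emeasure M {\<omega> \<in> space M. (other_durations \<omega>, last_durations \<omega>) \<in> Q} =
      ennreal (inverse \<bar>Determinant.det D\<bar>) * (\<integral>\<^sup>+y. density_term f t B y \<partial>(\<Pi>\<^sub>M a\<in>{..<H}. lborel))"
proof -
  let ?L = "\<Pi>\<^sub>M a\<in>{..<H}. lborel :: real measure"
  let ?L2 = "\<Pi>\<^sub>M c\<in>{..<2::nat}. lborel :: real measure"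
  let ?dens = "\<lambda>z. \<Prod>b<H. f (e b) (n (e b)) (z b)"
  note [measurable] = position_of_measurable[of t] B
  show Q: "Q \<in> sets (?L \<Otimes>\<^sub>M ?L2)"
  proof -
    have [measurable]: "(\<lambda>x. \<Sum>b<H. fst x b) \<in> borel_measurable (?L \<Otimes>\<^sub>M ?L2)"
    proof (rule borel_measurable_sum)
      fix b assume "b \<in> {..<H}"
      then have "(\<lambda>z. z b) \<in> borel_measurable ?L"
        using measurable_component_singleton[of b "{..<H}" "\<lambda>_. lborel :: real measure"] by simp
      with measurable_fst show "(\<lambda>x. fst x b) \<in> borel_measurable (?L \<Otimes>\<^sub>M ?L2)"
        by (rule measurable_compose)
    qed
    have [measurable]: "(\<lambda>x. snd x c) \<in> borel_measurable (?L \<Otimes>\<^sub>M ?L2)" if "c < 2" for c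
    proof -
      have "(\<lambda>z. z c) \<in> borel_measurable ?L2"
        using that measurable_component_singleton[of c "{..<2}" "\<lambda>_. lborel :: real measure"] by simp
      with measurable_snd show ?thesis
        by (rule measurable_compose)
    qed
    show ?thesis
      unfolding Q_def
      by (intro sets.sets_Collect_conj borel_measurable_less borel_measurable_le) measurable
  qed
  have n1: "n (i k) - 1 + 1 = n (i k)"
    using n_pos[OF k] by simp
  have in_Q: "(z, last_durations \<omega>) \<in> Q \<longleftrightarrow> position_of t z \<in> B \<and> last_velocity_event t z \<omega>"
    if "z \<in> space ?L" for z \<omega>
    using that n1 by (simp add: Q_def last_durations_def last_velocity_event_def space_pair_measure space_PiM)
  have last: "last_durations \<in> M \<rightarrow>\<^sub>M ?L2"
    using indep_durations by (rule indep_var_rv2)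
  have other: "other_durations \<omega> \<in> space ?L" for \<omega>
    by (simp add: other_durations_def space_PiM)
  show "(other_durations \<omega>, last_durations \<omega>) \<in> Q \<longleftrightarrow>
      position_of t (other_durations \<omega>) \<in> B \<and> last_velocity_event t (other_durations \<omega>) \<omega>"
    by (rule in_Q[OF other])
  have "?dens \<in> borel_measurable ?L"
  proof (rule borel_measurable_prod_ennreal)
    fix b assume b: "b \<in> {..<H}"
    then have "f (e b) (n (e b)) \<in> borel_measurable lborel"
      using dens[OF e_le n_pos[OF insert_index_le]] by (simp add: distributed_def)
    with measurable_component_singleton[OF b] show "(\<lambda>z. f (e b) (n (e b)) (z b)) \<in> borel_measurable ?L"
      by (rule measurable_compose)
  qed
  moreover have "(\<lambda>z. emeasure M {\<omega> \<in> space M. (z, last_durations \<omega>) \<in> Q}) \<in> borel_measurable ?L"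
  proof -
    let ?Q' = "(\<lambda>x. (fst x, last_durations (snd x))) -` Q \<inter> space (?L \<Otimes>\<^sub>M M)"
    have "(\<lambda>x. (fst x, last_durations (snd x))) \<in> ?L \<Otimes>\<^sub>M M \<rightarrow>\<^sub>M ?L \<Otimes>\<^sub>M ?L2"
      by (rule measurable_Pair[OF measurable_fst measurable_compose[OF measurable_snd last]])
    then have "?Q' \<in> sets (?L \<Otimes>\<^sub>M M)"
      using Q by (rule measurable_sets)
    then have "(\<lambda>z. emeasure M (Pair z -` ?Q')) \<in> borel_measurable ?L"
      by (rule measurable_emeasure_Pair)
    moreover have "Pair z -` ?Q' = {\<omega> \<in> space M. (z, last_durations \<omega>) \<in> Q}" if "z \<in> space ?L" for z
      using that by (auto simp: space_pair_measure)
    ultimately show ?thesis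
      by (simp cong: measurable_cong)
  qed
  moreover have "distr M ?L other_durations = density ?L ?dens"
    by (rule distr_other_durations) (rule dens)
  ultimately have "emeasure M {\<omega> \<in> space M. (other_durations \<omega>, last_durations \<omega>) \<in> Q} =
      (\<integral>\<^sup>+z. ?dens z * emeasure M {\<omega> \<in> space M. (z, last_durations \<omega>) \<in> Q} \<partial>?L)"
    unfolding emeasure_indep_var[OF indep_durations Q] by (simp add: nn_integral_density)
  also have "\<dots> = (\<integral>\<^sup>+z. density_term f t B (position_of t z) \<partial>?L)"
  proof (rule nn_integral_cong)
    fix z assume z: "z \<in> space ?L"
    show "?dens z * emeasure M {\<omega> \<in> space M. (z, last_durations \<omega>) \<in> Q} = density_term f t B (position_of t z)"
    proof (cases "position_of t z \<in> B")
      case True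
      have "(\<Sum>b<H. z b) = (\<Sum>b<H. g_inverse w H k t (position_of t z) (insert_index k b))"
        by (simp add: g_inverse_position_of)
      also have "\<dots> \<le> t"
        by (rule sum_g_inverse_le[OF u_affine_independent t k subsetD[OF B_hull True]])
      finally have "AE \<omega> in M. last_velocity_event t z \<omega> \<longleftrightarrow>
          count_until (\<lambda>m. duration_sum Wd (i k) m \<omega>) (t - (\<Sum>b<H. z b)) = enat (n (i k) - 1)"
        by (rule count_last_velocity)
      then have "AE \<omega> in M. \<omega> \<in> {\<omega> \<in> space M. (z, last_durations \<omega>) \<in> Q} \<longleftrightarrow>
          \<omega> \<in> {\<omega> \<in> space M. count_until (\<lambda>m. duration_sum Wd (i k) m \<omega>) (t - (\<Sum>b<H. z b)) =
            enat (n (i k) - 1)}"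
        by eventually_elim (simp add: in_Q[OF z] True)
      moreover have "{\<omega> \<in> space M. (z, last_durations \<omega>) \<in> Q} \<in> events"
        using measurable_sets[OF measurable_Pair[OF measurable_const[OF z] last] Q]
        by (simp add: vimage_def Int_def conj_commute)
      moreover have "{\<omega> \<in> space M. count_until (\<lambda>m. duration_sum Wd (i k) m \<omega>) (t - (\<Sum>b<H. z b)) =
          enat (n (i k) - 1)} \<in> events"
      proof -
        have "(\<lambda>\<omega>. count_until (\<lambda>m. duration_sum Wd (i k) m \<omega>) (t - (\<Sum>b<H. z b))) \<in> M \<rightarrow>\<^sub>M count_space UNIV"
          by (rule measurable_count_until) (simp_all add: duration_sum_measurable i_le[OF k])
        from measurable_sets[OF this, of "{enat (n (i k) - 1)}"] show ?thesis
          by (simp add: vimage_def Int_def conj_commute)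
      qed
      ultimately have "emeasure M {\<omega> \<in> space M. (z, last_durations \<omega>) \<in> Q} =
          count_probability (t - (\<Sum>b<H. z b))"
        unfolding count_probability_def by (rule emeasure_eq_AE)
      then show ?thesis
        using True by (simp add: density_term_def time_spent_position_of)
    next
      case False
      then show ?thesis
        using z by (simp add: in_Q density_term_def)
    qed
  qed
  also have "\<dots> = ennreal (inverse \<bar>Determinant.det D\<bar>) * (\<integral>\<^sup>+y. density_term f t B y \<partial>?L)"
  proof -
    have det: "Determinant.det D \<noteq> 0"
      by (rule det_difference_matrix_nonzero[OF w_affine_independent k])
    have "(\<integral>\<^sup>+y. density_term f t B y \<partial>?L) = ennreal \<bar>Determinant.det D\<bar> * (\<integral>\<^sup>+z. density_term f t B (position_of t z) \<partial>?L)"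
      unfolding position_of_def using det density_term_measurable
      by (intro nn_integral_PiM_affine) (simp_all add: difference_matrix_def)
    then have "ennreal (inverse \<bar>Determinant.det D\<bar>) * (\<integral>\<^sup>+y. density_term f t B y \<partial>?L) =
        (ennreal (inverse \<bar>Determinant.det D\<bar>) * ennreal \<bar>Determinant.det D\<bar>) *
        (\<integral>\<^sup>+z. density_term f t B (position_of t z) \<partial>?L)"
      by (simp add: mult.assoc)
    also have "ennreal (inverse \<bar>Determinant.det D\<bar>) * ennreal \<bar>Determinant.det D\<bar> = 1"
      using det by (simp add: ennreal_mult[symmetric])
    finally show ?thesis by simp
  qed
  finally show "emeasure M {\<omega> \<in> space M. (other_durations \<omega>, last_durations \<omega>) \<in> Q} =
      ennreal (inverse \<bar>Determinant.det D\<bar>) * (\<integral>\<^sup>+y. density_term f t B y \<partial>?L)" .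
qed

text \<open>
  Up to a null set the event is the intersection of one in the sigma-algebra of the durations with one
  in that of the allocation, and these are independent.
\<close>

lemma emeasure_event:
  defines "E \<equiv> {\<omega> \<in> space M.
      (\<forall>h\<le>H. displacements W V (v (i h)) t \<omega> = n (i h)) \<and>
      (\<forall>j\<in>{0..CARD('d)} - i ` {0..H}. displacements W V (v j) t \<omega> = 0) \<and> V t \<omega> = v (i k)}"
  shows "{\<omega> \<in> space M. p (X t \<omega>) \<in> B} \<inter> E \<in> events"
    and "emeasure M ({\<omega> \<in> space M. p (X t \<omega>) \<in> B} \<inter> E) = emeasure M {\<omega> \<in> space M. allocation \<omega>} *
      (ennreal (inverse \<bar>Determinant.det D\<bar>) * (\<integral>\<^sup>+y. density_term f t B y \<partial>(\<Pi>\<^sub>M a\<in>{..<H}. lborel)))"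
proof -
  let ?L = "\<Pi>\<^sub>M a\<in>{..<H}. lborel :: real measure"
  let ?L2 = "\<Pi>\<^sub>M c\<in>{..<2::nat}. lborel :: real measure"
  define Q where "Q = {x \<in> space (?L \<Otimes>\<^sub>M ?L2).
      position_of t (fst x) \<in> B \<and> snd x 0 \<le> t - (\<Sum>b<H. fst x b) \<and> t - (\<Sum>b<H. fst x b) < snd x 1}"
  define A where "A = {\<omega> \<in> space M. allocation \<omega>}"
  define G where "G = {\<omega> \<in> space M. (other_durations \<omega>, last_durations \<omega>) \<in> Q}"
  note Q = emeasure_durations_event[folded Q_def]
  have A: "A \<in> sets allocation_algebra"
    unfolding A_def by (rule allocation_event)
  have "G = (\<lambda>\<omega>. (other_durations \<omega>, last_durations \<omega>)) -` Q \<inter> space duration_algebra"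
    by (auto simp: G_def)
  then have G: "G \<in> sets duration_algebra"
    using measurable_sets[OF durations_measurable Q(1)] by simp
  have ev: "A \<in> events" "G \<in> events"
    using A G sets_algebras by auto
  have "E \<in> events"
  proof -
    have "{\<omega> \<in> space M. displacements W V x t \<omega> = c} \<in> events" for x c
      using measurable_sets[OF displacements_measurable[of x t], of "{c}"]
      by (simp add: vimage_def Int_def conj_commute)
    then have "{\<omega> \<in> space M. \<forall>h\<in>{..H}. displacements W V (v (i h)) t \<omega> = n (i h)} \<in> events"
      "{\<omega> \<in> space M. \<forall>j\<in>{0..CARD('d)} - i ` {0..H}. displacements W V (v j) t \<omega> = 0} \<in> events"
      by (intro sets.sets_Collect_finite_All; simp)+
    note disp = this
    have "{\<omega> \<in> space M. V t \<omega> = v (i k)} \<in> events"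
      using measurable_sets[OF V_measurable[OF t], of "{v (i k)}"]
      by (simp add: vimage_def Int_def conj_commute)
    from sets.sets_Collect_conj[OF this sets.sets_Collect_conj[OF disp(2,1)]]
    have "{\<omega> \<in> space M. ((\<forall>h\<in>{..H}. displacements W V (v (i h)) t \<omega> = n (i h)) \<and>
        (\<forall>j\<in>{0..CARD('d)} - i ` {0..H}. displacements W V (v j) t \<omega> = 0)) \<and> V t \<omega> = v (i k)} \<in> events"
      .
    moreover have "E = {\<omega> \<in> space M. ((\<forall>h\<in>{..H}. displacements W V (v (i h)) t \<omega> = n (i h)) \<and>
        (\<forall>j\<in>{0..CARD('d)} - i ` {0..H}. displacements W V (v j) t \<omega> = 0)) \<and> V t \<omega> = v (i k)}"
      unfolding E_def by auto
    ultimately show ?thesis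
      by (simp only:)
  qed
  moreover have "{\<omega> \<in> space M. p (X t \<omega>) \<in> B} \<in> events"
    using measurable_sets[OF measurable_compose[OF X_measurable[OF t] p_measurable] B]
    by (simp add: vimage_def Int_def conj_commute)
  ultimately show event: "{\<omega> \<in> space M. p (X t \<omega>) \<in> B} \<inter> E \<in> events"
    by (rule sets.Int[rotated])
  have "AE \<omega> in M. \<omega> \<in> {\<omega> \<in> space M. p (X t \<omega>) \<in> B} \<inter> E \<longleftrightarrow> \<omega> \<in> G \<inter> A"
    using AE_regular_path[OF t]
  proof eventually_elim
    case (elim \<omega>)
    then show ?case
      using event_iff[OF elim t, of B] Q(2)[of \<omega>] by (auto simp: E_def G_def A_def)
  qed
  then have "emeasure M ({\<omega> \<in> space M. p (X t \<omega>) \<in> B} \<inter> E) = emeasure M (G \<inter> A)"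
    using event ev by (intro emeasure_eq_AE) auto
  also have "\<dots> = emeasure M G * emeasure M A"
    using indep_setD[OF indep_algebras G A] by (simp add: emeasure_eq_measure ennreal_mult)
  also have "\<dots> = emeasure M A * (ennreal (inverse \<bar>Determinant.det D\<bar>) * (\<integral>\<^sup>+y. density_term f t B y \<partial>?L))"
    unfolding G_def Q(3) by (rule mult.commute)
  finally show "emeasure M ({\<omega> \<in> space M. p (X t \<omega>) \<in> B} \<inter> E) = emeasure M {\<omega> \<in> space M. allocation \<omega>} *
      (ennreal (inverse \<bar>Determinant.det D\<bar>) * (\<integral>\<^sup>+y. density_term f t B y \<partial>?L))"
    unfolding A_def .
qed

end

lemma has_density_on_selected_hull:
  assumes dens: "\<And>h m. h \<le> CARD('d) \<Longrightarrow> 1 \<le> m \<Longrightarrow> distributed M lborel (duration_sum Wd h m) (f h m)"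
    and t: "0 \<le> t"
  shows "has_density_on M (\<Pi>\<^sub>M a\<in>{..<H}. lborel) (\<lambda>\<omega>. p (X t \<omega>))
     {\<omega> \<in> space M.
        (\<forall>h\<le>H. displacements W V (v (i h)) t \<omega> = n (i h)) \<and>
        (\<forall>j\<in>{0..CARD('d)} - i ` {0..H}. displacements W V (v j) t \<omega> = 0) \<and> V t \<omega> = v (i k)}
     (p ` rel_interior (convex hull ((\<lambda>h. t *\<^sub>R u h) ` {0..H})))
     (\<lambda>y. (\<Prod>h\<in>{0..H} - {k}. f (i h) (n (i h)) (g_inverse w H k t y h))
        * ennreal (inverse \<bar>Determinant.det D\<bar>)
        * emeasure M {\<omega> \<in> space M.
            count_until (\<lambda>m. duration_sum Wd (i k) m \<omega>)
              (t - (\<Sum>h\<in>{0..H} - {k}. g_inverse w H k t y h)) = enat (n (i k) - 1)}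
        * emeasure M {\<omega> \<in> space M.
            (\<forall>h\<le>CARD('d). selections W V (v h) (\<Sum>h=0..H. n (i h)) \<omega> = n h) \<and>
            step_velocity W V ((\<Sum>h=0..H. n (i h)) - 1) \<omega> = v (i k)})"
    (is "has_density_on M ?L ?Y ?E ?U ?g")
proof -
  let ?P = "emeasure M {\<omega> \<in> space M. allocation \<omega>}"
  let ?det = "ennreal (inverse \<bar>Determinant.det D\<bar>)"
  have "?g y * indicator B y = (?P * ?det) * density_term f t B y" for y B
  proof -
    have "(\<Prod>h\<in>{0..H} - {k}. f (i h) (n (i h)) (g_inverse w H k t y h)) =
        (\<Prod>b<H. f (e b) (n (e b)) (time_spent t y b))"
      unfolding time_spent_def by (rule prod.reindex_bij_betw[OF bij_e, symmetric])
    moreover have "(\<Sum>h\<in>{0..H} - {k}. g_inverse w H k t y h) = (\<Sum>b<H. time_spent t y b)"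
      unfolding time_spent_def by (rule sum.reindex_bij_betw[OF bij_e, symmetric])
    ultimately show ?thesis
      unfolding density_term_def count_probability_def allocation_def total_steps_def
      by (simp only: mult_ac)
  qed
  moreover have "{\<omega> \<in> space M. ?Y \<omega> \<in> B} \<inter> ?E \<in> events \<and>
      (\<lambda>y. (?P * ?det) * density_term f t B y) \<in> borel_measurable ?L \<and>
      emeasure M ({\<omega> \<in> space M. ?Y \<omega> \<in> B} \<inter> ?E) = (\<integral>\<^sup>+y. (?P * ?det) * density_term f t B y \<partial>?L)"
    if B: "B \<in> sets ?L" "B \<subseteq> ?U" for B
  proof -
    have "?U \<subseteq> p ` (convex hull ((\<lambda>h. t *\<^sub>R u h) ` {0..H}))"
      by (intro image_mono rel_interior_subset)
    with B(2) have hull: "B \<subseteq> p ` (convex hull ((\<lambda>h. t *\<^sub>R u h) ` {0..H}))"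
      by (rule order_trans)
    have meas: "density_term f t B \<in> borel_measurable ?L"
      by (rule density_term_measurable[OF _ t B(1) hull]) (rule dens)
    have event: "{\<omega> \<in> space M. ?Y \<omega> \<in> B} \<inter> ?E \<in> events"
      by (rule emeasure_event(1)[OF _ t B(1) hull]) (rule dens)
    have prob: "emeasure M ({\<omega> \<in> space M. ?Y \<omega> \<in> B} \<inter> ?E) = ?P * (?det * (\<integral>\<^sup>+y. density_term f t B y \<partial>?L))"
      by (rule emeasure_event(2)[OF _ t B(1) hull]) (rule dens)
    have "(\<integral>\<^sup>+y. (?P * ?det) * density_term f t B y \<partial>?L) = (?P * ?det) * (\<integral>\<^sup>+y. density_term f t B y \<partial>?L)"
      using meas by (rule nn_integral_cmult)
    with event prob meas show ?thesis
      by (simp add: mult.assoc borel_measurable_times)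
  qed
  ultimately show ?thesis
    unfolding has_density_on_def by simp
qed

end

theorem theorem2p3:
  fixes M :: "'a measure"
    and W :: "nat \<Rightarrow> 'a \<Rightarrow> real"
    and V X :: "real \<Rightarrow> 'a \<Rightarrow> real ^ 'd::{finite,linorder}"
    and v :: "nat \<Rightarrow> real ^ 'd::{finite,linorder}"
    and Wd :: "nat \<Rightarrow> nat \<Rightarrow> 'a \<Rightarrow> real"
    and f :: "nat \<Rightarrow> nat \<Rightarrow> real \<Rightarrow> ennreal"
    and H :: nat and i :: "nat \<Rightarrow> nat"
  defines "u \<equiv> \<lambda>h. v (i h)"
  defines "p \<equiv> hull_projection u H"
  defines "w \<equiv> \<lambda>h. p (u h)"
  assumes motion: "minimal_random_motion M W V X v Wd"
    and dens: "\<And>h n. h \<le> CARD('d) \<Longrightarrow> 1 \<le> n \<Longrightarrow>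
          distributed M lborel (duration_sum Wd h n) (f h n)"
    and H: "H < CARD('d)"
    and i_inj: "inj_on i {0..H}"
    and i_range: "i ` {0..H} \<subseteq> {0..CARD('d)}"
  shows
    "aff_dim (convex hull (u ` {0..H})) = int H \<and>
     (\<forall>l\<le>H. card (first_independent_rows u H l) = H \<and>
             first_independent_rows u H l = first_independent_rows u H 0) \<and>
     affinely_independent_family H {0..H} w \<and>
     (\<forall>t\<ge>0. \<forall>n :: nat \<Rightarrow> nat. \<forall>k\<le>H.
        (\<forall>h\<le>H. 1 \<le> n (i h)) \<and> (\<forall>j\<in>{0..CARD('d)} - i ` {0..H}. n j = 0) \<longrightarrow>
        has_density_on M (\<Pi>\<^sub>M a\<in>{..<H}. lborel) (\<lambda>\<omega>. p (X t \<omega>))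
          {\<omega> \<in> space M.
             (\<forall>h\<le>H. displacements W V (v (i h)) t \<omega> = n (i h)) \<and>
             (\<forall>j\<in>{0..CARD('d)} - i ` {0..H}. displacements W V (v j) t \<omega> = 0) \<and>
             V t \<omega> = v (i k)}
          (p ` rel_interior (convex hull ((\<lambda>h. t *\<^sub>R u h) ` {0..H})))
          (\<lambda>y. (\<Prod>h\<in>{0..H} - {k}. f (i h) (n (i h)) (g_inverse w H k t y h))
             * ennreal (inverse \<bar>Determinant.det (difference_matrix w H k)\<bar>)
             * emeasure M {\<omega> \<in> space M.
                 count_until (\<lambda>m. duration_sum Wd (i k) m \<omega>)
                   (t - (\<Sum>h\<in>{0..H} - {k}. g_inverse w H k t y h)) = enat (n (i k) - 1)}
             * emeasure M {\<omega> \<in> space M.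
                 (\<forall>h\<le>CARD('d). selections W V (v h) (\<Sum>h=0..H. n (i h)) \<omega> = n h) \<and>
                 step_velocity W V ((\<Sum>h=0..H. n (i h)) - 1) \<omega> = v (i k)}))"
proof -
  interpret minimal_random_motion M W V X v Wd
    by (rule motion)
  note u_inj = selected_velocities_affine_independent(1)[OF i_inj i_range, folded u_def]
  note u_indep = selected_velocities_affine_independent(2)[OF i_inj i_range, folded u_def]
  have "aff_dim (convex hull (u ` {0..H})) = int H"
    using aff_dim_affine_independent[OF u_indep] card_image[OF u_inj]
    by (simp add: aff_dim_convex_hull)
  moreover have "card (first_independent_rows u H l) = H \<and>
      first_independent_rows u H l = first_independent_rows u H 0" if "l \<le> H" for l
    using first_independent_rows_base_point[OF that, of u] card_first_independent_rows[OF u_inj u_indep]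
    by simp
  moreover have "affinely_independent_family H {0..H} w"
    unfolding w_def p_def by (rule affinely_independent_hull_projection[OF u_inj u_indep])
  moreover have "has_density_on M (\<Pi>\<^sub>M a\<in>{..<H}. lborel) (\<lambda>\<omega>. p (X t \<omega>))
          {\<omega> \<in> space M.
             (\<forall>h\<le>H. displacements W V (v (i h)) t \<omega> = n (i h)) \<and>
             (\<forall>j\<in>{0..CARD('d)} - i ` {0..H}. displacements W V (v j) t \<omega> = 0) \<and>
             V t \<omega> = v (i k)}
          (p ` rel_interior (convex hull ((\<lambda>h. t *\<^sub>R u h) ` {0..H})))
          (\<lambda>y. (\<Prod>h\<in>{0..H} - {k}. f (i h) (n (i h)) (g_inverse w H k t y h))
             * ennreal (inverse \<bar>Determinant.det (difference_matrix w H k)\<bar>)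
             * emeasure M {\<omega> \<in> space M.
                 count_until (\<lambda>m. duration_sum Wd (i k) m \<omega>)
                   (t - (\<Sum>h\<in>{0..H} - {k}. g_inverse w H k t y h)) = enat (n (i k) - 1)}
             * emeasure M {\<omega> \<in> space M.
                 (\<forall>h\<le>CARD('d). selections W V (v h) (\<Sum>h=0..H. n (i h)) \<omega> = n h) \<and>
                 step_velocity W V ((\<Sum>h=0..H. n (i h)) - 1) \<omega> = v (i k)})"
    if "0 \<le> t" "k \<le> H" "(\<forall>h\<le>H. 1 \<le> n (i h)) \<and> (\<forall>j\<in>{0..CARD('d)} - i ` {0..H}. n j = 0)"
    for t k and n :: "nat \<Rightarrow> nat"
  proof -
    interpret velocity_selection M W V X v Wd H k i n
      using i_inj i_range that by unfold_locales auto
    show ?thesis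
      unfolding w_def p_def u_def by (rule has_density_on_selected_hull[OF _ that(1)]) (rule dens)
  qed
  ultimately show ?thesis
    by blast
qed

end
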